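(* Let $p\geq 3$ be an integer and let $P(x)=x^{2p+1}+k_px^{p+1}+k_{p+1}x^{p}+\dots+k_{2p}x+k_{2p+1}$ be a real polynomial with $P(x)\neq x^{2p+1}$. Consider the following three cases: 1) $k_p<0$, $k_{p+1}<0$, $k_{p+2}=\dots=k_{2p}=0$ and $k_{2p+1}=k_pk_{p+1}$; 2) $k_p<0$, $k_{p+1}<0$, $k_{p+2}=\dots=k_{2p-1}=0$, $0<k_{2p}<\frac{k_p^2}{4}$ and $k_{2p+1}=k_{p+1}\left(\frac{k_p}{2}-\sqrt{\frac{k_p^2}{4}-k_{2p}}\right)$; 3) $k_p<0$, $k_{p+1}=\dots=k_{2p-1}=k_{2p+1}=0$ and $k_{2p}=\frac{k_p^2}{4}$. If none of the cases 1), 2), 3) holds, then $P(x)$ is $\mathcal{R}$ if and only if $P(x)$ is $\mathcal{IR}$. If one of the cases 1), 2), 3) holds, then $P(x)$ is not $\mathcal{IR}$.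
   Context: A monic real polynomial $P(x)$ of degree $n$ is realizable ($\mathcal{R}$) if it is the characteristic polynomial of some $n\times n$ entrywise nonnegative matrix; it is irreducibly realizable ($\mathcal{IR}$) if it is the characteristic polynomial of some $n\times n$ irreducible entrywise nonnegative matrix. A square matrix is irreducible if it is not similar by a permutation matrix to a nontrivially block triangular matrix (equivalently, its digraph is strongly connected). *)

theory Defs
  imports "Jordan_Normal_Form.Char_Poly"
begin

definition nonneg_mat :: "real mat \<Rightarrow> bool" where
  "nonneg_mat A \<longleftrightarrow> (\<forall>i < dim_row A. \<forall>j < dim_col A. 0 \<le> A $$ (i, j))"

definition permutation_mat :: "nat \<Rightarrow> 'a :: zero_neq_one mat \<Rightarrow> bool" where
  "permutation_mat n Q \<longleftrightarrow>
     (\<exists>\<sigma>. \<sigma> permutes {..<n} \<and> Q = mat n n (\<lambda>(i, j). if i = \<sigma> j then 1 else 0))"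

text \<open>
  Two diagonal blocks suffice, since a block triangular matrix with more blocks can be
  repartitioned. Up to permutation similarity, it does not matter whether upper or lower
  triangular matrices are taken: exchanging the two groups of indices turns one into the other.
\<close>
definition nontriv_block_triangular :: "'a :: zero mat \<Rightarrow> bool" where
  "nontriv_block_triangular B \<longleftrightarrow>
     (\<exists>r s B1 B2 B4. 0 < r \<and> 0 < s \<and> B1 \<in> carrier_mat r r \<and> B2 \<in> carrier_mat r s \<and>
        B4 \<in> carrier_mat s s \<and> B = four_block_mat B1 B2 (0\<^sub>m s r) B4)"

definition irreducible_mat :: "'a :: semiring_1 mat \<Rightarrow> bool" where
  "irreducible_mat A \<longleftrightarrow>
     \<not> (\<exists>B Q Q'. permutation_mat (dim_row A) Q \<and> similar_mat_wit A B Q Q' \<and>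
          nontriv_block_triangular B)"

definition realizable :: "real poly \<Rightarrow> bool" where
  "realizable P \<longleftrightarrow>
     (\<exists>A \<in> carrier_mat (degree P) (degree P). nonneg_mat A \<and> char_poly A = P)"

definition irreducibly_realizable :: "real poly \<Rightarrow> bool" where
  "irreducibly_realizable P \<longleftrightarrow>
     (\<exists>A \<in> carrier_mat (degree P) (degree P).
        nonneg_mat A \<and> irreducible_mat A \<and> char_poly A = P)"

definition case1 :: "nat \<Rightarrow> (nat \<Rightarrow> real) \<Rightarrow> bool" where
  "case1 p k \<longleftrightarrow>
     k p < 0 \<and> k (p + 1) < 0 \<and> (\<forall>j \<in> {p + 2..2 * p}. k j = 0) \<and>
     k (2 * p + 1) = k p * k (p + 1)"

definition case2 :: "nat \<Rightarrow> (nat \<Rightarrow> real) \<Rightarrow> bool" where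
  "case2 p k \<longleftrightarrow>
     k p < 0 \<and> k (p + 1) < 0 \<and> (\<forall>j \<in> {p + 2..2 * p - 1}. k j = 0) \<and>
     0 < k (2 * p) \<and> k (2 * p) < (k p)\<^sup>2 / 4 \<and>
     k (2 * p + 1) = k (p + 1) * (k p / 2 - sqrt ((k p)\<^sup>2 / 4 - k (2 * p)))"

definition case3 :: "nat \<Rightarrow> (nat \<Rightarrow> real) \<Rightarrow> bool" where
  "case3 p k \<longleftrightarrow>
     k p < 0 \<and> (\<forall>j \<in> {p + 1..2 * p - 1}. k j = 0) \<and> k (2 * p + 1) = 0 \<and>
     k (2 * p) = (k p)\<^sup>2 / 4"

end

theory Submission
  imports Defs "HOL-Combinatorics.Cycles" "HOL-Combinatorics.Orbits"
    "HOL-Library.Transitive_Closure_Table"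
begin

text \<open>
  The coefficients of the characteristic polynomial of a nonnegative matrix are signed sums of
  weights of disjoint unions of cycles in its digraph. As the coefficients of index below \<open>p\<close>
  vanish, every cycle has length at least \<open>p\<close>, and on \<open>2p+1\<close> vertices only pairs of type \<open>(p, p)\<close>
  and \<open>(p, p+1)\<close> can be disjoint. Let \<open>\<alpha>\<close> and \<open>\<beta>\<close> be the total weights of the \<open>p\<close>- and
  \<open>(p+1)\<close>-cycles and \<open>s\<close> the maximal weight of a pairwise intersecting family of \<open>p\<close>-cycles. Since no
  three \<open>p\<close>-sets are pairwise disjoint, the weighted Mantel argument gives
  \<open>k\<^bsub>2p\<^esub> \<le> s (\<alpha> - s)\<close>, and clearly \<open>k\<^bsub>2p+1\<^esub> \<le> \<beta> s\<close>. In the three exceptional cases both are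
  equalities, which forces all cycles into two complementary vertex sets, so the digraph is not
  strongly connected. In all other cases the resulting necessary conditions suffice to
  write down an irreducible matrix, almost always a Hessenberg matrix whose cycles are intervals.
\<close>

section \<open>Irreducibility and strong connectivity\<close>

text \<open>The bound \<open>k (2 * p) \<le> s * (\<alpha> - s)\<close> places \<open>s\<close>
  below the larger root \<open>t\<close> of the corresponding equation, or below \<alpha> if the
  root exceeds it; this root is the origin of the square root in case 2. With it the second bound
  becomes \<open>k (2 * p + 1) \<le> \<beta> * t\<close>, a condition on the coefficients alone.
  Both bounds are attained by two disjoint \<open>p\<close>-cycles of weights \<open>t\<close> and
  \<open>\<alpha> - t\<close>, with all \<open>(p + 1)\<close>-cycles on the complement of the
  first. In this model no cycle meets both blocks. They can be linked if some inequality is strict,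
  since the deficit is then the weight of a longer cycle, or if the weights can be redistributed
  without changing the coefficients: \<open>t = \<alpha> / 2\<close> lets both sides share \<beta>,
  and \<beta> = 0 frees weight of the \<open>p\<close>-cycles unless
  \<open>k (2 * p) = \<alpha>\<^sup>2 / 4\<close>. The rigid distributions that remain are the three
  cases: \<open>t = \<alpha>\<close> in case 1, \<open>\<alpha> / 2 < t < \<alpha>\<close> in case
  2, \<open>t = \<alpha> / 2\<close> with \<beta> = 0 in case 3.\<close>

text \<open>Multiplication by \<open>Q\<close> on the right turns the similarity into
  \<open>A * Q = Q * B\<close>; at position \<open>(\<sigma> i, j)\<close> the permutation matrix
  selects a single summand on each side.\<close>

lemma permuted_mat_eq:
  fixes A :: "'a :: comm_semiring_1 mat"
  assumes A: "A \<in> carrier_mat n n" and s: "\<sigma> permutes {..<n}"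
    and sim: "similar_mat_wit A B (mat n n (\<lambda>(i, j). if i = \<sigma> j then 1 else 0)) Q'"
    and ij: "i < n" "j < n"
  shows "B $$ (i, j) = A $$ (\<sigma> i, \<sigma> j)"
proof -
  let ?Q = "mat n n (\<lambda>(i, j). if i = \<sigma> j then 1 else 0) :: 'a mat"
  note AB = similar_mat_witD2(3)[OF A sim] and Q'Q = similar_mat_witD2(2)[OF A sim]
    and B = similar_mat_witD2(5)[OF A sim] and Q = similar_mat_witD2(6)[OF A sim]
    and Q' = similar_mat_witD2(7)[OF A sim]
  have si: "\<sigma> i < n" "\<sigma> j < n"
    using permutes_in_image[OF s] ij by auto
  have QB: "?Q * B \<in> carrier_mat n n" by (rule mult_carrier_mat[OF Q B])
  have eq: "A * ?Q = ?Q * B"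
    unfolding AB assoc_mult_mat[OF QB Q' Q] Q'Q by (rule right_mult_one_mat[OF QB])
  have "(A * ?Q) $$ (\<sigma> i, j) = (\<Sum>l\<in>{0..<n}. A $$ (\<sigma> i, l) * (if l = \<sigma> j then 1 else 0))"
    using A si ij by (simp add: scalar_prod_def)
  also have "\<dots> = (\<Sum>l\<in>{0..<n}. if l = \<sigma> j then A $$ (\<sigma> i, l) else 0)"
    by (intro sum.cong) auto
  also have "\<dots> = A $$ (\<sigma> i, \<sigma> j)" using si by simp
  finally have 1: "(A * ?Q) $$ (\<sigma> i, j) = A $$ (\<sigma> i, \<sigma> j)" .
  have "(?Q * B) $$ (\<sigma> i, j) = (\<Sum>l\<in>{0..<n}. (if \<sigma> i = \<sigma> l then 1 else 0) * B $$ (l, j))"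
    using B si ij by (simp add: scalar_prod_def)
  also have "\<dots> = (\<Sum>l\<in>{0..<n}. if l = i then B $$ (l, j) else 0)"
    using permutes_inj[OF s] by (intro sum.cong) (auto simp: inj_eq)
  also have "\<dots> = B $$ (i, j)" using ij by simp
  finally show ?thesis using 1 eq by simp
qed

lemma permutation_enumerating_initial_segment:
  assumes "W \<subseteq> {..<n}"
  obtains \<sigma> where "\<sigma> permutes {..<n}" "\<sigma> ` {..<card W} = W"
proof -
  have fin: "finite W" using assms finite_subset by blast
  have c: "card W \<le> n" using card_mono[OF _ assms] by simp
  obtain g where g: "bij_betw g {..<card W} W"
    using ex_bij_betw_nat_finite[OF fin] by (auto simp: atLeast0LessThan)
  have "card {card W..<n} = card ({..<n} - W)"
    using assms fin by (simp add: card_Diff_subset)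
  then obtain h where h: "bij_betw h {card W..<n} ({..<n} - W)"
    using finite_same_card_bij[of "{card W..<n}" "{..<n} - W"] by auto
  define \<sigma> where "\<sigma> i = (if i < n then if i < card W then g i else h i else i)" for i
  have 1: "bij_betw \<sigma> {..<card W} W"
    using g c by (subst bij_betw_cong[of _ _ g]) (auto simp: \<sigma>_def)
  have 2: "bij_betw \<sigma> {card W..<n} ({..<n} - W)"
    using h by (subst bij_betw_cong[of _ _ h]) (auto simp: \<sigma>_def)
  have "bij_betw \<sigma> ({..<card W} \<union> {card W..<n}) (W \<union> ({..<n} - W))"
    by (rule bij_betw_combine[OF 1 2]) auto
  moreover have "{..<card W} \<union> {card W..<n} = {..<n}" "W \<union> ({..<n} - W) = {..<n}"
    using c assms by auto
  ultimately have "\<sigma> permutes {..<n}"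
    by (intro bij_imp_permutes) (auto simp: \<sigma>_def)
  moreover have "\<sigma> ` {..<card W} = W" using 1 by (simp add: bij_betw_def)
  ultimately show ?thesis using that by blast
qed

lemma permutation_mat_inverse:
  assumes s: "\<sigma> permutes {..<n}"
  defines "Q \<equiv> \<lambda>\<tau>. mat n n (\<lambda>(i, j). if i = \<tau> j then 1 else 0) :: 'a :: comm_semiring_1 mat"
  shows "Q \<sigma> * Q (inv_into UNIV \<sigma>) = 1\<^sub>m n"
proof (rule eq_matI)
  fix i j assume "i < dim_row (1\<^sub>m n)" "j < dim_col (1\<^sub>m n)"
  hence ij: "i < n" "j < n" by auto
  have ij': "inv_into UNIV \<sigma> j < n" using permutes_in_image[OF permutes_inv[OF s]] ij by auto
  have "(Q \<sigma> * Q (inv_into UNIV \<sigma>)) $$ (i, j) =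
     (\<Sum>l\<in>{0..<n}. (if i = \<sigma> l then 1 else 0) * (if l = inv_into UNIV \<sigma> j then 1 else 0))"
    using ij by (simp add: Q_def scalar_prod_def)
  also have "\<dots> = (\<Sum>l\<in>{0..<n}. if l = inv_into UNIV \<sigma> j then if i = \<sigma> l then 1 else 0 else 0)"
    by (intro sum.cong) auto
  also have "\<dots> = (if i = \<sigma> (inv_into UNIV \<sigma> j) then 1 else 0)"
    using ij' by simp
  also have "\<dots> = 1\<^sub>m n $$ (i, j)" using ij permutes_inverses[OF s] by auto
  finally show "(Q \<sigma> * Q (inv_into UNIV \<sigma>)) $$ (i, j) = 1\<^sub>m n $$ (i, j)" .
qed (auto simp: Q_def)

text \<open>A zero lower left block means that the later indices have no edge to the earlier ones.
  So a reducing permutation lists a set \<open>W\<close> without outgoing edges last and its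
  complement first.\<close>

lemma irreducible_mat_iff:
  fixes A :: "'a :: comm_semiring_1 mat"
  assumes A: "A \<in> carrier_mat n n"
  shows "irreducible_mat A \<longleftrightarrow>
    (\<forall>W. W \<subseteq> {..<n} \<longrightarrow> W \<noteq> {} \<longrightarrow> W \<noteq> {..<n} \<longrightarrow> (\<exists>i\<in>W. \<exists>j\<in>{..<n} - W. A $$ (i, j) \<noteq> 0))"
proof (intro iffI allI impI)
  fix W assume irr: "irreducible_mat A" and W: "W \<subseteq> {..<n}" "W \<noteq> {}" "W \<noteq> {..<n}"
  show "\<exists>i\<in>W. \<exists>j\<in>{..<n} - W. A $$ (i, j) \<noteq> 0"
  proof (rule ccontr)
    assume "\<not> ?thesis"
    hence closed: "A $$ (i, j) = 0" if "i \<in> W" "j < n" "j \<notin> W" for i j using that by auto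
    define r where "r = card ({..<n} - W)"
    have fin: "finite W" using W finite_subset by blast
    have "card W \<le> n" using card_mono[OF _ W(1)] by simp
    moreover have "card W \<noteq> n" "card W \<noteq> 0"
      using card_subset_eq[OF _ W(1)] W fin by auto
    moreover have "r = n - card W" unfolding r_def using W(1) fin by (simp add: card_Diff_subset)
    ultimately have r: "0 < r" "r < n" by auto
    obtain \<sigma> where s: "\<sigma> permutes {..<n}" and im: "\<sigma> ` {..<r} = {..<n} - W"
      unfolding r_def by (rule permutation_enumerating_initial_segment[of "{..<n} - W" n]) auto
    define Q where "Q \<tau> = (mat n n (\<lambda>(i, j). if i = \<tau> j then 1 else 0) :: 'a mat)" for \<tau>
    have Q: "Q \<tau> \<in> carrier_mat n n" for \<tau> by (simp add: Q_def)
    have QQ: "Q \<sigma> * Q (inv_into UNIV \<sigma>) = 1\<^sub>m n"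
      unfolding Q_def by (rule permutation_mat_inverse[OF s])
    have QQ': "Q (inv_into UNIV \<sigma>) * Q \<sigma> = 1\<^sub>m n"
      using permutation_mat_inverse[OF permutes_inv[OF s], where 'a = 'a]
      unfolding Q_def permutes_inv_inv[OF s] .
    define B where "B = Q (inv_into UNIV \<sigma>) * A * Q \<sigma>"
    have B: "B \<in> carrier_mat n n" unfolding B_def by (rule mult_carrier_mat[OF mult_carrier_mat[OF Q A] Q])
    have "similar_mat_wit B A (Q (inv_into UNIV \<sigma>)) (Q \<sigma>)"
      by (rule similar_mat_witI[OF QQ' QQ B_def B A Q Q])
    hence sim: "similar_mat_wit A B (Q \<sigma>) (Q (inv_into UNIV \<sigma>))" by (rule similar_mat_wit_sym)
    have Bij: "B $$ (i, j) = A $$ (\<sigma> i, \<sigma> j)" if "i < n" "j < n" for i j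
      using permuted_mat_eq[OF A s sim[unfolded Q_def] that] .
    have z: "B $$ (i, j) = 0" if "r \<le> i" "i < n" "j < r" for i j
    proof -
      have "\<sigma> j \<in> {..<n} - W" using im that by auto
      moreover have "\<sigma> i \<notin> {..<n} - W" unfolding im[symmetric]
        using that permutes_inj[OF s] by (auto simp: inj_eq)
      moreover have "\<sigma> i < n" using permutes_in_image[OF s] that by auto
      ultimately show ?thesis using Bij[of i j] closed[of "\<sigma> i" "\<sigma> j"] that r by auto
    qed
    define B1 where "B1 = mat r r (($$) B)"
    define B2 where "B2 = mat r (n - r) (\<lambda>(i, j). B $$ (i, j + r))"
    define B4 where "B4 = mat (n - r) (n - r) (\<lambda>(i, j). B $$ (i + r, j + r))"
    have "B1 \<in> carrier_mat r r" "B2 \<in> carrier_mat r (n - r)" "B4 \<in> carrier_mat (n - r) (n - r)"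
      by (simp_all add: B1_def B2_def B4_def)
    moreover have "B = four_block_mat B1 B2 (0\<^sub>m (n - r) r) B4"
    proof (rule eq_matI)
      fix i j assume "i < dim_row (four_block_mat B1 B2 (0\<^sub>m (n - r) r) B4)"
        "j < dim_col (four_block_mat B1 B2 (0\<^sub>m (n - r) r) B4)"
      thus "B $$ (i, j) = four_block_mat B1 B2 (0\<^sub>m (n - r) r) B4 $$ (i, j)"
        using z[of i j] r by (auto simp: B1_def B2_def B4_def not_less)
    qed (use B r in \<open>auto simp: B1_def B2_def B4_def\<close>)
    ultimately have "nontriv_block_triangular B"
      unfolding nontriv_block_triangular_def using r
      by (intro exI[of _ r] exI[of _ "n - r"] exI[of _ B1] exI[of _ B2] exI[of _ B4] conjI) simp_all
    moreover have "permutation_mat (dim_row A) (Q \<sigma>)"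
      unfolding permutation_mat_def Q_def using s A by auto
    ultimately show False using irr sim unfolding irreducible_mat_def by blast
  qed
next
  assume conn: "\<forall>W. W \<subseteq> {..<n} \<longrightarrow> W \<noteq> {} \<longrightarrow> W \<noteq> {..<n} \<longrightarrow>
    (\<exists>i\<in>W. \<exists>j\<in>{..<n} - W. A $$ (i, j) \<noteq> 0)"
  show "irreducible_mat A"
    unfolding irreducible_mat_def
  proof
    assume "\<exists>B Q Q'. permutation_mat (dim_row A) Q \<and> similar_mat_wit A B Q Q' \<and> nontriv_block_triangular B"
    then obtain B Q Q' where Q: "permutation_mat (dim_row A) Q" and sim: "similar_mat_wit A B Q Q'"
      and nt: "nontriv_block_triangular B" by blast
    obtain \<sigma> where s: "\<sigma> permutes {..<n}" and Qe: "Q = mat n n (\<lambda>(i, j). if i = \<sigma> j then 1 else 0)"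
      using Q A unfolding permutation_mat_def by auto
    from nt obtain r s B1 B2 B4 where rs: "0 < r" "0 < s" and c: "B1 \<in> carrier_mat r r"
      "B2 \<in> carrier_mat r s" "B4 \<in> carrier_mat s s" and B: "B = four_block_mat B1 B2 (0\<^sub>m s r) B4"
      unfolding nontriv_block_triangular_def by blast
    have "B \<in> carrier_mat n n" by (rule similar_mat_witD2(5)[OF A sim])
    hence n: "n = r + s" using B c by auto
    define W where "W = \<sigma> ` {r..<n}"
    have lt: "\<sigma> i < n \<longleftrightarrow> i < n" for i using permutes_in_image[OF s, of i] by simp
    have W: "W \<subseteq> {..<n}" unfolding W_def by (auto simp: lt)
    have "\<sigma> 0 \<notin> W" unfolding W_def using permutes_inj[OF s] rs by (auto simp: inj_eq)
    moreover have "\<sigma> 0 < n" using lt[of 0] n rs by linarith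
    ultimately have "W \<noteq> {..<n}" by auto
    moreover have "W \<noteq> {}" unfolding W_def using rs n by auto
    ultimately obtain i j where ij: "i \<in> W" "j < n" "j \<notin> W" "A $$ (i, j) \<noteq> 0" using conn W by blast
    obtain i' where i': "i = \<sigma> i'" "i' \<in> {r..<n}" using ij(1) unfolding W_def by blast
    obtain j' where j': "j = \<sigma> j'" "j' < n" using ij(2) permutes_image[OF s]
      by (metis image_iff lessThan_iff)
    have "j' < r" using ij(3) j' unfolding W_def by (metis atLeastLessThan_iff image_eqI not_less)
    moreover have "i' < n" using i' by simp
    ultimately have "B $$ (i', j') = 0" unfolding B using c(1,3) i' n by simp
    thus False using permuted_mat_eq[OF A s sim[unfolded Qe] \<open>i' < n\<close> j'(2)] ij(4) i' j' by simp
  qed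
qed

section \<open>Characteristic polynomials of Hessenberg matrices\<close>

lemma cramer_unit_rhs:
  fixes M :: "'a :: comm_ring_1 mat"
  assumes M: "M \<in> carrier_mat n n" and r: "r < n" and c: "c < n"
    and Mu: "\<And>i. i < n \<Longrightarrow> (\<Sum>j<n. M $$ (i, j) * u j) = (if i = r then q else 0)"
  shows "det M * u c = q * cofactor M r c"
proof -
  have adj: "adj_mat M \<in> carrier_mat n n" using adj_mat(1)[OF M] .
  have "M *\<^sub>v vec n u = vec n (\<lambda>i. if i = r then q else 0)"
    using M Mu by (intro eq_vecI) (auto simp: scalar_prod_def atLeast0LessThan)
  hence "(adj_mat M * M) *\<^sub>v vec n u = adj_mat M *\<^sub>v vec n (\<lambda>i. if i = r then q else 0)"
    using assoc_mult_mat_vec[OF adj M, of "vec n u"] by simp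
  hence "((det M \<cdot>\<^sub>m 1\<^sub>m n) *\<^sub>v vec n u) $ c = (adj_mat M *\<^sub>v vec n (\<lambda>i. if i = r then q else 0)) $ c"
    using adj_mat(3)[OF M] by simp
  moreover have "((det M \<cdot>\<^sub>m 1\<^sub>m n) *\<^sub>v vec n u) $ c = det M * u c"
  proof -
    have "((det M \<cdot>\<^sub>m 1\<^sub>m n) *\<^sub>v vec n u) $ c =
        (\<Sum>i\<in>{0..<n}. det M * (if i = c then 1 else 0) * u i)"
      using c by (simp add: scalar_prod_def)
    also have "\<dots> = (\<Sum>i\<in>{0..<n}. if i = c then det M * u i else 0)"
      by (intro sum.cong) auto
    finally show ?thesis using c by simp
  qed
  moreover have "(adj_mat M *\<^sub>v vec n (\<lambda>i. if i = r then q else 0)) $ c = adj_mat M $$ (c, r) * q"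
  proof -
    have "(adj_mat M *\<^sub>v vec n (\<lambda>i. if i = r then q else 0)) $ c =
        (\<Sum>i\<in>{0..<n}. adj_mat M $$ (c, i) * (if i = r then q else 0))"
      using c adj by (simp add: scalar_prod_def)
    also have "\<dots> = (\<Sum>i\<in>{0..<n}. if i = r then adj_mat M $$ (c, i) * q else 0)"
      by (intro sum.cong) auto
    finally show ?thesis using r by simp
  qed
  moreover have "adj_mat M $$ (c, r) = cofactor M r c"
    using M r c by (simp add: adj_mat_def)
  ultimately show ?thesis using c r by (simp add: mult_ac)
qed

text \<open>With ones above the diagonal, every cycle of the weighted digraph runs through an interval of
  indices; \<open>w l j\<close> is the weight of the cycle on \<open>{j..<j + l}\<close>.\<close>

definition hessenberg_mat :: "nat \<Rightarrow> (nat \<Rightarrow> nat \<Rightarrow> real) \<Rightarrow> real mat" where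
  "hessenberg_mat n w =
     mat n n (\<lambda>(i, j). if j = i + 1 then 1 else if j \<le> i then w (i + 1 - j) j else 0)"

text \<open>The characteristic polynomial of the leading \<open>m\<close> by \<open>m\<close> block,
  split by its last index: either that index lies on no chosen cycle (factor \<open>x\<close>), or
  on one with interval \<open>{j..<Suc m}\<close>, which leaves the first \<open>j\<close>
  indices.\<close>

fun hessenberg_poly :: "(nat \<Rightarrow> nat \<Rightarrow> real) \<Rightarrow> nat \<Rightarrow> real poly" where
  "hessenberg_poly w 0 = 1"
| "hessenberg_poly w (Suc m) =
     monom 1 1 * hessenberg_poly w m - (\<Sum>j<Suc m. [:w (Suc m - j) j:] * hessenberg_poly w j)"

lemma char_poly_hessenberg:
  "char_poly (hessenberg_mat n w) = hessenberg_poly w n"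
proof (cases n)
  case 0
  thus ?thesis by (simp add: hessenberg_mat_def char_poly_def det_dim_zero)
next
  case (Suc m)
  define M where "M = char_poly_matrix (hessenberg_mat n w)"
  let ?u = "hessenberg_poly w"
  have M: "M \<in> carrier_mat n n" by (simp add: M_def hessenberg_mat_def)
  have entry: "M $$ (i, j) = (if j = i then monom 1 1 else 0) -
     (if j = i + 1 then 1 else if j \<le> i then [:w (i + 1 - j) j:] else 0)" if "i < n" "j < n" for i j
    using that by (auto simp: M_def char_poly_matrix_def hessenberg_mat_def monom_altdef)
  \<comment> \<open>The polynomials of the leading blocks solve the first \<open>n - 1\<close> equations of \<open>(x I - A) u = 0\<close>.\<close>
  have "(\<Sum>j<n. M $$ (i, j) * ?u j) = (if i = m then ?u n else 0)" if i: "i < n" for i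
  proof -
    have "(\<Sum>j<n. M $$ (i, j) * ?u j) = (\<Sum>j<n. (if j = i then monom 1 1 * ?u j else 0)) -
      (\<Sum>j<n. if j = i + 1 then ?u j else 0) - (\<Sum>j<n. if j \<le> i then [:w (i + 1 - j) j:] * ?u j else 0)"
      unfolding sum_subtractf[symmetric] using i by (intro sum.cong) (auto simp: entry algebra_simps)
    also have "(\<Sum>j<n. if j \<le> i then [:w (i + 1 - j) j:] * ?u j else 0) =
       (\<Sum>j<Suc i. [:w (Suc i - j) j:] * ?u j)"
      using i by (intro sum.mono_neutral_cong_right) auto
    also have "(\<Sum>j<n. (if j = i then monom 1 1 * ?u j else 0)) = monom 1 1 * ?u i" using i by simp
    also have "(\<Sum>j<n. if j = i + 1 then ?u j else 0) = (if i = m then 0 else ?u (Suc i))"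
      using i Suc by auto
    finally show ?thesis using Suc by simp
  qed
  hence "det M * ?u 0 = ?u n * cofactor M m 0"
    by (intro cramer_unit_rhs[OF M]) (auto simp: Suc)
  \<comment> \<open>Without the last row and the first column the matrix is lower triangular with
    \<open>-1\<close> on the diagonal; its determinant cancels the sign of the cofactor.\<close>
  moreover have "cofactor M m 0 = 1"
  proof -
    let ?N = "mat_delete M m 0"
    have N: "?N \<in> carrier_mat m m" using M Suc by (simp add: mat_delete_def)
    have Ne: "?N $$ (i, j) = M $$ (i, Suc j)" if "i < m" "j < m" for i j
      using that M Suc by (simp add: mat_delete_def)
    have "det ?N = prod_list (diag_mat ?N)"
      by (rule det_lower_triangular[OF _ N]) (auto simp: Ne entry Suc)
    also have "\<dots> = (\<Prod>i\<in>{0..<m}. ?N $$ (i, i))"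
      using prod_list_diag_prod[of ?N] carrier_matD(1)[OF N] by metis
    also have "\<dots> = (\<Prod>i\<in>{0..<m}. - 1)" by (intro prod.cong) (auto simp: Ne entry Suc)
    finally show ?thesis by (simp add: cofactor_def flip: power_mult_distrib)
  qed
  ultimately show ?thesis by (simp add: M_def char_poly_def)
qed

section \<open>Counting at most two disjoint intervals\<close>

lemma pCons_mult_monom: "[:c:] * monom d m = monom (c * d) m" for c d :: "'a :: comm_semiring_0"
  by (simp add: smult_monom)

definition interval_poly :: "nat \<Rightarrow> (nat \<Rightarrow> nat \<Rightarrow> real) \<Rightarrow> nat \<Rightarrow> real poly" where
  "interval_poly p w m = monom 1 m - (\<Sum>l=p..m. monom (\<Sum>j\<le>m-l. w l j) (m - l))"

text \<open>If all intervals have length at least \<open>p\<close>, at most two of them fit disjointly into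
  \<open>2 * p + 1\<close> indices; \<open>interval_poly\<close> counts the configurations with at most one interval.\<close>

context
  fixes p :: nat and w :: "nat \<Rightarrow> nat \<Rightarrow> real"
  assumes p: "p \<ge> 2" and w0: "\<And>l j. l < p \<Longrightarrow> w l j = 0"
begin

text \<open>The new intervals are those ending at the last index, one for each start
  \<open>j\<close>; all others gain a factor \<open>x\<close>. Lengths below \<open>p\<close> carry
  no weight, so \<open>j\<close> may run over all starts.\<close>

lemma interval_poly_Suc:
  "interval_poly p w (Suc m) = monom 1 1 * interval_poly p w m - (\<Sum>j<Suc m. monom (w (Suc m - j) j) j)"
proof -
  have "(\<Sum>l=p..Suc m. monom (\<Sum>j\<le>Suc m-l. w l j) (Suc m - l)) =
    (\<Sum>l=p..Suc m. (if l \<le> m then monom (\<Sum>j\<le>m-l. w l j) (Suc m - l) else 0)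
       + monom (w l (Suc m - l)) (Suc m - l))"
  proof (rule sum.cong[OF refl], goal_cases)
    case (1 l)
    thus ?case by (cases "l = Suc m") (auto simp: Suc_diff_le add_monom)
  qed
  also have "\<dots> = (\<Sum>l=p..Suc m. (if l \<le> m then monom (\<Sum>j\<le>m-l. w l j) (Suc m - l) else 0)) +
      (\<Sum>l=p..Suc m. monom (w l (Suc m - l)) (Suc m - l))"
    by (simp only: sum.distrib)
  also have "(\<Sum>l=p..Suc m. (if l \<le> m then monom (\<Sum>j\<le>m-l. w l j) (Suc m - l) else 0)) =
     (\<Sum>l=p..m. monom 1 1 * monom (\<Sum>j\<le>m-l. w l j) (m - l))"
    by (intro sum.mono_neutral_cong_right) (auto simp: mult_monom Suc_diff_le)
  also have "(\<Sum>l=p..Suc m. monom (w l (Suc m - l)) (Suc m - l)) =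
      (\<Sum>l=1..Suc m. monom (w l (Suc m - l)) (Suc m - l))"
    using p by (intro sum.mono_neutral_left) (auto simp: w0)
  also have "\<dots> = (\<Sum>j<Suc m. monom (w (Suc m - j) j) j)"
    by (rule sum.reindex_bij_witness[of _ "\<lambda>j. Suc m - j" "\<lambda>l. Suc m - l"]) auto
  finally show ?thesis
    by (simp add: interval_poly_def algebra_simps sum_distrib_left mult_monom)
qed

lemma hessenberg_poly_small: "m < p \<Longrightarrow> hessenberg_poly w m = monom 1 m"
proof (induction m)
  case (Suc m)
  thus ?case by (simp add: w0 mult_monom)
qed (simp add: monom_0)

text \<open>In the recursion a start \<open>j < p\<close> leaves no room for a second interval, and
  a start \<open>j \<ge> p\<close> makes the last interval shorter than \<open>p\<close>.\<close>

lemma hessenberg_poly_eq_interval_poly: "m < 2 * p \<Longrightarrow> hessenberg_poly w m = interval_poly p w m"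
proof (induction m)
  case 0
  thus ?case using p by (simp add: interval_poly_def monom_0)
next
  case (Suc m)
  have "(\<Sum>j<Suc m. [:w (Suc m - j) j:] * hessenberg_poly w j) = (\<Sum>j<Suc m. monom (w (Suc m - j) j) j)"
  proof (rule sum.cong[OF refl], goal_cases)
    case (1 j)
    show ?case
    proof (cases "j < p")
      case False
      hence "Suc m - j < p" using Suc.prems by auto
      thus ?thesis by (simp add: w0)
    qed (simp add: hessenberg_poly_small pCons_mult_monom del: mult_pCons_left)
  qed
  thus ?case using Suc by (simp add: interval_poly_Suc del: mult_pCons_left sum.lessThan_Suc)
qed

lemma hessenberg_poly_p: "hessenberg_poly w p = monom 1 p - [:w p 0:]"
  using p by (subst hessenberg_poly_eq_interval_poly) (auto simp: interval_poly_def monom_0)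

lemma hessenberg_poly_Suc_p:
  "hessenberg_poly w (Suc p) = monom 1 (Suc p) - monom (w p 0 + w p 1) 1 - [:w (Suc p) 0:]"
  using p by (subst hessenberg_poly_eq_interval_poly) (auto simp: interval_poly_def monom_0)

lemma hessenberg_poly_double:
  "hessenberg_poly w (2 * p) = interval_poly p w (2 * p) + [:w p p * w p 0:]"
proof -
  obtain m where m: "2 * p = Suc m" using p by (cases "2 * p") auto
  have "(\<Sum>j<Suc m. [:w (Suc m - j) j:] * hessenberg_poly w j) =
     (\<Sum>j<Suc m. monom (w (Suc m - j) j) j - (if j = p then [:w p p * w p 0:] else 0))"
  proof (rule sum.cong[OF refl], goal_cases)
    case (1 j)
    consider "j < p" | "j = p" | "j > p" by linarith
    thus ?case
    proof cases
      case 1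
      thus ?thesis by (simp add: hessenberg_poly_small pCons_mult_monom del: mult_pCons_left)
    next
      case 2
      have "Suc m - p = p" using m by auto
      thus ?thesis using 2 by (simp add: hessenberg_poly_p algebra_simps smult_monom)
    next
      case 3
      hence "Suc m - j < p" using m by auto
      thus ?thesis using 3 by (simp add: w0)
    qed
  qed
  also have "\<dots> = (\<Sum>j<Suc m. monom (w (Suc m - j) j) j) - [:w p p * w p 0:]"
    using m p by (simp add: sum_subtractf del: sum.lessThan_Suc)
  finally show ?thesis
    unfolding m hessenberg_poly.simps interval_poly_Suc
    using m by (simp add: hessenberg_poly_eq_interval_poly)
qed

text \<open>Pairs have three sources: those avoiding the last index
  (\<open>hessenberg_poly_double\<close>, times \<open>x\<close>), a last interval of length
  \<open>p + 1\<close> (\<open>j = p\<close>), and one of length \<open>p\<close>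
  (\<open>j = p + 1\<close>), beside which a \<open>p\<close>-interval may start at 0 or 1 or a
  \<open>(p + 1)\<close>-interval at 0.\<close>

lemma hessenberg_poly_double_Suc:
  "hessenberg_poly w (2 * p + 1) = interval_poly p w (2 * p + 1) +
     monom (w p p * w p 0 + w p (p + 1) * (w p 0 + w p 1)) 1 +
     monom (w (p + 1) p * w p 0 + w p (p + 1) * w (p + 1) 0) 0"
proof -
  define m where "m = 2 * p"
  have "(\<Sum>j<Suc m. [:w (Suc m - j) j:] * hessenberg_poly w j) =
     (\<Sum>j<Suc m. monom (w (Suc m - j) j) j - (if j = p then [:w (p + 1) p * w p 0:] else 0)
       - (if j = p + 1 then monom (w p (p + 1) * (w p 0 + w p 1)) 1 + [:w p (p + 1) * w (p + 1) 0:] else 0))"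
  proof (rule sum.cong[OF refl], goal_cases)
    case (1 j)
    consider "j < p" | "j = p" | "j = p + 1" | "j > p + 1" by linarith
    thus ?case
    proof cases
      case 1
      thus ?thesis by (simp add: hessenberg_poly_small pCons_mult_monom del: mult_pCons_left)
    next
      case 2
      have "Suc m - p = p + 1" using m_def by auto
      thus ?thesis using 2 by (simp add: hessenberg_poly_p algebra_simps smult_monom)
    next
      case 3
      have "Suc m - (p + 1) = p" using m_def by auto
      thus ?thesis using 3
        by (simp add: hessenberg_poly_Suc_p algebra_simps smult_monom del: hessenberg_poly.simps)
    next
      case 4
      hence "Suc m - j < p" using m_def p by auto
      thus ?thesis using 4 by (simp add: w0)
    qed
  qed
  also have "\<dots> = (\<Sum>j<Suc m. monom (w (Suc m - j) j) j) - [:w (p + 1) p * w p 0:]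
     - (monom (w p (p + 1) * (w p 0 + w p 1)) 1 + [:w p (p + 1) * w (p + 1) 0:])"
    using m_def p by (simp add: sum_subtractf del: sum.lessThan_Suc)
  finally have S: "(\<Sum>j<Suc m. [:w (Suc m - j) j:] * hessenberg_poly w j) =
     (\<Sum>j<Suc m. monom (w (Suc m - j) j) j) - [:w (p + 1) p * w p 0:]
     - (monom (w p (p + 1) * (w p 0 + w p 1)) 1 + [:w p (p + 1) * w (p + 1) 0:])" .
  have D: "hessenberg_poly w m = interval_poly p w m + [:w p p * w p 0:]"
    unfolding m_def by (rule hessenberg_poly_double)
  have "hessenberg_poly w (Suc m) = interval_poly p w (Suc m) + monom 1 1 * [:w p p * w p 0:]
     + [:w (p + 1) p * w p 0:] + (monom (w p (p + 1) * (w p 0 + w p 1)) 1 + [:w p (p + 1) * w (p + 1) 0:])"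
    unfolding hessenberg_poly.simps(2) interval_poly_Suc S D by (simp only: algebra_simps)
  thus ?thesis by (simp add: m_def monom_0 smult_monom mult_monom algebra_simps flip: add_monom)
qed

end

section \<open>Irreducible realizations\<close>

definition gap_poly :: "nat \<Rightarrow> (nat \<Rightarrow> real) \<Rightarrow> real poly" where
  "gap_poly p k = monom 1 (2 * p + 1) + (\<Sum>j = p..2 * p + 1. monom (k j) (2 * p + 1 - j))"

lemma coeff_gap_poly:
  assumes "p \<ge> 1" "m \<le> 2 * p + 1"
  shows "coeff (gap_poly p k) (2 * p + 1 - m) = (if m = 0 then 1 else if p \<le> m then k m else 0)"
proof -
  have "(\<Sum>j = p..2 * p + 1. coeff (monom (k j) (2 * p + 1 - j)) (2 * p + 1 - m)) =
     (\<Sum>j = p..2 * p + 1. if j = m then k j else 0)"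
    using assms by (intro sum.cong) auto
  thus ?thesis using assms by (auto simp: gap_poly_def coeff_sum)
qed

lemma degree_gap_poly:
  assumes "p \<ge> 1"
  shows "degree (gap_poly p k) = 2 * p + 1"
proof (rule antisym)
  show "degree (gap_poly p k) \<le> 2 * p + 1"
    unfolding gap_poly_def
    by (intro degree_add_le degree_sum_le degree_monom_le order_trans[OF degree_monom_le]) auto
  show "2 * p + 1 \<le> degree (gap_poly p k)"
    using coeff_gap_poly[OF assms, of 0 k] by (intro le_degree) simp
qed

text \<open>The superdiagonal makes every set closed under edges a final segment
  \<open>{m..<n}\<close>. A cycle whose interval contains \<open>m - 1\<close> and \<open>m\<close>
  returns from its last index to a start below \<open>m\<close>, so \<open>m\<close> must be
  0.\<close>

lemma irreducible_hessenberg_mat: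
  assumes cover: "\<And>c. Suc c < n \<Longrightarrow> \<exists>l j. j \<le> c \<and> c + 1 < j + l \<and> j + l \<le> n \<and> w l j \<noteq> 0"
  shows "irreducible_mat (hessenberg_mat n w)"
proof -
  have A: "hessenberg_mat n w \<in> carrier_mat n n" by (simp add: hessenberg_mat_def)
  show ?thesis unfolding irreducible_mat_iff[OF A]
  proof (intro allI impI, rule ccontr)
    fix W assume W: "W \<subseteq> {..<n}" "W \<noteq> {}" "W \<noteq> {..<n}"
      and "\<not> (\<exists>i\<in>W. \<exists>j\<in>{..<n} - W. hessenberg_mat n w $$ (i, j) \<noteq> 0)"
    hence closed: "j \<in> W" if "i \<in> W" "j < n" "hessenberg_mat n w $$ (i, j) \<noteq> 0" for i j
      using that by blast
    have step: "Suc i \<in> W" if "i \<in> W" "Suc i < n" for i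
      using closed[of i "Suc i"] that by (auto simp: hessenberg_mat_def)
    have up: "i + d \<in> W" if "i \<in> W" "i + d < n" for i d
      using that(2) by (induction d) (use that(1) step in auto)
    define m where "m = (LEAST i. i \<in> W)"
    have m: "m \<in> W" using W(2) unfolding m_def by (meson LeastI ex_in_conv)
    have least: "m \<le> i" if "i \<in> W" for i unfolding m_def by (rule Least_le) fact
    have Weq: "i \<in> W" if "m \<le> i" "i < n" for i using up[OF m, of "i - m"] that by simp
    have mn: "m < n" using m W by auto
    have "m \<noteq> 0" using Weq W by auto
    then obtain c where c: "m = Suc c" by (cases m) auto
    obtain l j where lj: "j \<le> c" "c + 1 < j + l" "j + l \<le> n" "w l j \<noteq> 0"
      using cover[of c] mn c by auto
    have "hessenberg_mat n w $$ (j + l - 1, j) = w l j"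
      using lj by (auto simp: hessenberg_mat_def)
    hence "j \<in> W" using lj c by (intro closed[OF Weq[of "j + l - 1"]]) auto
    thus False using least[of j] lj c by auto
  qed
qed

lemma hessenberg_realization:
  fixes w :: "nat \<Rightarrow> nat \<Rightarrow> real"
  assumes p: "p \<ge> 2" and w0: "\<And>l j. l < p \<Longrightarrow> w l j = 0" and nonneg: "\<And>l j. 0 \<le> w l j"
    and cover: "\<And>c. c < 2 * p \<Longrightarrow> \<exists>l j. j \<le> c \<and> c + 1 < j + l \<and> j + l \<le> 2 * p + 1 \<and> w l j \<noteq> 0"
    and k: "\<And>l. p \<le> l \<Longrightarrow> l < 2 * p \<Longrightarrow> k l = - (\<Sum>j\<le>2 * p + 1 - l. w l j)"
    and k2p: "k (2 * p) = w p p * w p 0 + w p (p + 1) * (w p 0 + w p 1) - (w (2 * p) 0 + w (2 * p) 1)"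
    and k2p1: "k (2 * p + 1) = w (p + 1) p * w p 0 + w p (p + 1) * w (p + 1) 0 - w (2 * p + 1) 0"
  shows "irreducibly_realizable (gap_poly p k)"
proof -
  let ?A = "hessenberg_mat (2 * p + 1) w"
  let ?d = "w p p * w p 0 + w p (p + 1) * (w p 0 + w p 1)"
  let ?e = "w (p + 1) p * w p 0 + w p (p + 1) * w (p + 1) 0"
  have eq: "{p..2 * p + 1} = {p..<2 * p} \<union> {2 * p, 2 * p + 1}" using p by auto
  have split: "(\<Sum>l = p..2 * p + 1. f l) = (\<Sum>l = p..<2 * p. f l) + f (2 * p) + f (2 * p + 1)"
    for f :: "nat \<Rightarrow> real poly"
    unfolding eq by (subst sum.union_disjoint) auto
  have "char_poly ?A = interval_poly p w (2 * p + 1) + monom ?d 1 + monom ?e 0"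
    unfolding char_poly_hessenberg by (rule hessenberg_poly_double_Suc[OF p w0])
  also have "\<dots> = gap_poly p k"
  proof -
    have s1: "(\<Sum>l = p..<2 * p. monom (k l) (2 * p + 1 - l)) =
        - (\<Sum>l = p..<2 * p. monom (\<Sum>j\<le>2 * p + 1 - l. w l j) (2 * p + 1 - l))"
      unfolding sum_negf[symmetric] by (intro sum.cong) (auto simp: k minus_monom)
    have s2: "(\<Sum>j\<le>2 * p + 1 - 2 * p. w (2 * p) j) = w (2 * p) 0 + w (2 * p) 1" by simp
    have s3: "(\<Sum>j\<le>2 * p + 1 - (2 * p + 1). w (2 * p + 1) j) = w (2 * p + 1) 0" by simp
    have k2p': "monom (k (2 * p)) (2 * p + 1 - 2 * p) = monom ?d 1 - monom (w (2 * p) 0 + w (2 * p) 1) 1"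
      unfolding k2p diff_monom by simp
    have k2p1': "monom (k (2 * p + 1)) (2 * p + 1 - (2 * p + 1)) = monom ?e 0 - monom (w (2 * p + 1) 0) 0"
      unfolding k2p1 diff_monom by simp
    show ?thesis
      unfolding interval_poly_def gap_poly_def split s1 s2 s3 k2p' k2p1' by simp
  qed
  finally have cp: "char_poly ?A = gap_poly p k" .
  have "irreducible_mat ?A" by (rule irreducible_hessenberg_mat) (use cover in auto)
  moreover have "nonneg_mat ?A" using nonneg by (auto simp: nonneg_mat_def hessenberg_mat_def)
  moreover have "?A \<in> carrier_mat (degree (gap_poly p k)) (degree (gap_poly p k))"
    using p by (simp add: degree_gap_poly hessenberg_mat_def)
  ultimately show ?thesis using cp unfolding irreducibly_realizable_def by blast
qed

text \<open>Here \<open>x\<^sub>0, x\<^sub>2, x\<^sub>1\<close> are the weights of the \<open>p\<close>-cycles starting at \<open>0\<close>, \<open>2\<close>, \<open>p + 1\<close>,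
  and \<open>y\<^sub>0, y\<^sub>1\<close> those of the \<open>(p + 1)\<close>-cycles starting at \<open>0\<close> and \<open>p\<close>. Each longer cycle length
  is split evenly between both ends, so that a single length of positive weight already
  makes the digraph strongly connected.\<close>

lemma interval_realization:
  fixes k :: "nat \<Rightarrow> real"
  assumes p: "p \<ge> 3"
    and nonneg: "0 \<le> x\<^sub>0" "0 \<le> x\<^sub>2" "0 \<le> x\<^sub>1" "0 \<le> y\<^sub>0" "0 \<le> y\<^sub>1"
    and kp: "k p = - (x\<^sub>0 + x\<^sub>2 + x\<^sub>1)" and kp1: "k (p + 1) = - (y\<^sub>0 + y\<^sub>1)"
    and kl: "\<And>l. p + 2 \<le> l \<Longrightarrow> l < 2 * p \<Longrightarrow> k l \<le> 0"
    and k2p: "k (2 * p) \<le> x\<^sub>1 * x\<^sub>0" and k2p1: "k (2 * p + 1) \<le> y\<^sub>1 * x\<^sub>0 + x\<^sub>1 * y\<^sub>0"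
    and cover: "(\<exists>l. p + 2 \<le> l \<and> l < 2 * p \<and> k l < 0) \<or> k (2 * p) < x\<^sub>1 * x\<^sub>0 \<or>
       k (2 * p + 1) < y\<^sub>1 * x\<^sub>0 + x\<^sub>1 * y\<^sub>0 \<or> (0 < y\<^sub>0 \<and> 0 < y\<^sub>1) \<or> (0 < x\<^sub>0 \<and> 0 < x\<^sub>2 \<and> 0 < x\<^sub>1)"
  shows "irreducibly_realizable (gap_poly p k)"
proof -
  \<comment> \<open>The weight needed on cycles of length \<open>l\<close> to bring the products of
    disjoint cycles down to \<open>k l\<close>.\<close>
  define z where "z l = (if l = 2 * p then x\<^sub>1 * x\<^sub>0 - k l
     else if l = 2 * p + 1 then y\<^sub>1 * x\<^sub>0 + x\<^sub>1 * y\<^sub>0 - k l else - k l)" for l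
  \<comment> \<open>The \<open>p\<close>-interval from 2 to \<open>p + 1\<close> meets both outer
    ones (for the first, by \<open>p \<ge> 3\<close>), so it enters no product; from start 1 it
    would miss the one at \<open>p + 1\<close>. For \<open>l = 2 * p + 1\<close> the two ends
    coincide and the halves of \<open>z l\<close> add up. Beyond that length \<open>k\<close> is
    unconstrained, hence the default 0.\<close>
  define w where "w l j = (if l < p \<or> 2 * p + 1 < l then 0
     else if l = p then (if j = 0 then x\<^sub>0 else if j = 2 then x\<^sub>2 else if j = p + 1 then x\<^sub>1 else 0)
     else if l = p + 1 then (if j = 0 then y\<^sub>0 else if j = p then y\<^sub>1 else 0)
     else (if j = 0 then z l / 2 else 0) + (if j = 2 * p + 1 - l then z l / 2 else 0))" for l j
  have z: "0 \<le> z l" if "p + 2 \<le> l" "l \<le> 2 * p + 1" for l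
    using that kl[of l] k2p k2p1 by (auto simp: z_def)
  have wz: "w l j = (if j = 0 then z l / 2 else 0) + (if j = 2 * p + 1 - l then z l / 2 else 0)"
    if "p + 2 \<le> l" "l \<le> 2 * p + 1" for l j using that by (auto simp: w_def)
  have wp: "w p j = (if j = 0 then x\<^sub>0 else 0) + (if j = 2 then x\<^sub>2 else 0) + (if j = p + 1 then x\<^sub>1 else 0)" for j
    using p by (auto simp: w_def)
  have wp1: "w (p + 1) j = (if j = 0 then y\<^sub>0 else 0) + (if j = p then y\<^sub>1 else 0)" for j
    using p by (auto simp: w_def)
  show ?thesis
  proof (rule hessenberg_realization[where w = w])
    show "2 \<le> p" using p by simp
    show "w l j = 0" if "l < p" for l j using that by (simp add: w_def)
    show "0 \<le> w l j" for l j
    proof (cases "p + 2 \<le> l \<and> l \<le> 2 * p + 1")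
      case True
      thus ?thesis using z[of l] by (simp add: wz)
    next
      case False
      hence "l < p \<or> 2 * p + 1 < l \<or> l = p \<or> l = p + 1" by linarith
      thus ?thesis using nonneg by (elim disjE) (simp_all add: w_def)
    qed
    show "k l = - (\<Sum>j\<le>2 * p + 1 - l. w l j)" if l: "p \<le> l" "l < 2 * p" for l
    proof -
      consider "l = p" | "l = p + 1" | "p + 2 \<le> l" using l by linarith
      thus ?thesis
      proof cases
        case 1
        show ?thesis unfolding 1 wp using p by (simp add: sum.distrib kp)
      next
        case 2
        show ?thesis unfolding 2 wp1 using p kp1 by (simp add: sum.distrib)
      next
        case 3
        have "(\<Sum>j\<le>2 * p + 1 - l. w l j) = z l" using 3 l by (simp add: wz sum.distrib)
        thus ?thesis using l by (simp add: z_def)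
      qed
    qed
    show "k (2 * p) = w p p * w p 0 + w p (p + 1) * (w p 0 + w p 1) - (w (2 * p) 0 + w (2 * p) 1)"
      using p by (simp add: wp wz z_def)
    show "k (2 * p + 1) = w (p + 1) p * w p 0 + w p (p + 1) * w (p + 1) 0 - w (2 * p + 1) 0"
      unfolding wp1 wp using p by (simp add: wz z_def)
    fix c assume c: "c < 2 * p"
    \<comment> \<open>The two end intervals of such a length overlap, so each pair \<open>c\<close>,
      \<open>c + 1\<close> lies in one of them.\<close>
    have long: "\<exists>l j. j \<le> c \<and> c + 1 < j + l \<and> j + l \<le> 2 * p + 1 \<and> w l j \<noteq> 0" if l: "p + 2 \<le> l" "l \<le> 2 * p + 1" "0 < z l" for l
    proof (cases "c + 1 < l")
      case True
      thus ?thesis using l z[of l] by (intro exI[of _ l] exI[of _ 0]) (auto simp: wz)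
    next
      case False
      thus ?thesis using l c z[of l] by (intro exI[of _ l] exI[of _ "2 * p + 1 - l"]) (auto simp: wz)
    qed
    from cover show "\<exists>l j. j \<le> c \<and> c + 1 < j + l \<and> j + l \<le> 2 * p + 1 \<and> w l j \<noteq> 0"
    proof (elim disjE exE conjE)
      fix l assume "p + 2 \<le> l" "l < 2 * p" "k l < 0"
      thus ?thesis by (intro long[of l]) (auto simp: z_def)
    next
      assume "k (2 * p) < x\<^sub>1 * x\<^sub>0"
      thus ?thesis using p by (intro long[of "2 * p"]) (auto simp: z_def)
    next
      assume "k (2 * p + 1) < y\<^sub>1 * x\<^sub>0 + x\<^sub>1 * y\<^sub>0"
      thus ?thesis using p by (intro long[of "2 * p + 1"]) (auto simp: z_def)
    next
      assume y: "0 < y\<^sub>0" "0 < y\<^sub>1"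
      show ?thesis
      proof (cases "c < p")
        case True
        thus ?thesis using y p by (intro exI[of _ "p + 1"] exI[of _ 0]) (auto simp: wp1[simplified])
      next
        case False
        thus ?thesis using y p c by (intro exI[of _ "p + 1"] exI[of _ p]) (auto simp: wp1[simplified])
      qed
    next
      assume x: "0 < x\<^sub>0" "0 < x\<^sub>2" "0 < x\<^sub>1"
      consider "c + 1 < p" | "p + 1 \<le> c" | "p \<le> c + 1" "c < p + 1" by linarith
      thus ?thesis
      proof cases
        case 1
        thus ?thesis using x p by (intro exI[of _ p] exI[of _ 0]) (auto simp: wp)
      next
        case 2
        thus ?thesis using x p c by (intro exI[of _ p] exI[of _ "p + 1"]) (auto simp: wp)
      next
        case 3
        thus ?thesis using x p c by (intro exI[of _ p] exI[of _ 2]) (auto simp: wp)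
      qed
    qed
  qed
qed

text \<open>For \<open>x\<^bsup>2p+1\<^esup> - a x\<^bsup>p+1\<^esup>\<close> no Hessenberg matrix works. All cycles of the following matrix are
  \<open>0 \<rightarrow> d \<rightarrow> p - 2 \<rightarrow> p - 3 \<rightarrow> \<dots> \<rightarrow> 1 \<rightarrow> 0\<close> with one of the \<open>p + 2\<close> vertices \<open>d \<ge> p - 1\<close>.\<close>

definition hub_mat :: "nat \<Rightarrow> real \<Rightarrow> real mat" where
  "hub_mat p a = mat (2 * p + 1) (2 * p + 1) (\<lambda>(i, j).
     if i = 0 then (if p - 1 \<le> j then 1 else 0)
     else if i < p - 1 then (if j = i - 1 then 1 else 0)
     else (if j = p - 2 then a / (p + 2) else 0))"

text \<open>The vector \<open>u\<close> solves all rows of \<open>(x I - A) u = 0\<close> except row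
  0, where \<open>x ^ p - a\<close> remains, as each of the \<open>p + 2\<close> edges from 0
  contributes \<open>a / (p + 2)\<close>. Every cycle uses vertex 0, so its cofactor is
  \<open>x ^ (2 * p)\<close>; finally \<open>u 0 = x ^ (p - 1)\<close> is cancelled.\<close>

lemma char_poly_hub_mat:
  assumes p: "p \<ge> 3"
  shows "char_poly (hub_mat p a) = monom 1 (2 * p + 1) - monom a (p + 1)"
proof -
  define M where "M = char_poly_matrix (hub_mat p a)"
  define u :: "nat \<Rightarrow> real poly" where
    "u j = (if j < p - 1 then monom 1 (p - 1 - j) else [:a / (p + 2):])" for j
  let ?n = "2 * p + 1" and ?h = "\<lambda>i j. hub_mat p a $$ (i, j)"
  have M: "M \<in> carrier_mat ?n ?n" by (simp add: M_def hub_mat_def)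
  have entry: "M $$ (i, j) = (if j = i then monom 1 1 else 0) - [:?h i j:]" if "i < ?n" "j < ?n" for i j
    using that by (auto simp: M_def char_poly_matrix_def hub_mat_def monom_altdef)
  have row: "(\<Sum>j<?n. M $$ (i, j) * u j) = monom 1 1 * u i - (\<Sum>j<?n. [:?h i j:] * u j)" if "i < ?n" for i
  proof -
    have "(\<Sum>j<?n. M $$ (i, j) * u j) =
       (\<Sum>j<?n. (if j = i then monom 1 1 * u j else 0) - [:?h i j:] * u j)"
      using that by (intro sum.cong) (auto simp: entry algebra_simps)
    thus ?thesis using that by (simp add: sum_subtractf)
  qed
  have "(\<Sum>j<?n. M $$ (i, j) * u j) = (if i = 0 then monom 1 p - [:a:] else 0)" if i: "i < ?n" for i
  proof -
    consider "i = 0" | "0 < i" "i < p - 1" | "p - 1 \<le> i" "0 < i" by linarith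
    thus ?thesis
    proof cases
      case 1
      have "(\<Sum>j<?n. [:?h i j:] * u j) = (\<Sum>j\<in>{p - 1..<?n}. [:a / (p + 2):])"
        using 1 p by (intro sum.mono_neutral_cong_right) (auto simp: hub_mat_def u_def)
      also have "\<dots> = [:a:]" using p by (simp add: of_nat_poly)
      finally show ?thesis using 1 p row[OF i] by (simp add: u_def mult_monom)
    next
      case 2
      have "(\<Sum>j<?n. [:?h i j:] * u j) = (\<Sum>j\<in>{i - 1}. u j)"
        using 2 i p by (intro sum.mono_neutral_cong_right) (auto simp: hub_mat_def)
      also have "\<dots> = monom 1 1 * u i" using 2 by (simp add: u_def mult_monom Suc_diff_Suc)
      finally show ?thesis using 2 row[OF i] by simp
    next
      case 3
      have "(\<Sum>j<?n. [:?h i j:] * u j) = (\<Sum>j\<in>{p - 2}. [:a / (p + 2):] * u j)"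
        using 3 i p by (intro sum.mono_neutral_cong_right) (auto simp: hub_mat_def)
      also have "\<dots> = monom 1 1 * u i"
      proof -
        obtain q where "p = q + 3" using p nat_le_iff_add by (metis add.commute)
        thus ?thesis using 3 by (simp add: u_def)
      qed
      finally show ?thesis using 3 row[OF i] by simp
    qed
  qed
  hence "det M * u 0 = (monom 1 p - [:a:]) * cofactor M 0 0"
    by (intro cramer_unit_rhs[OF M]) auto
  moreover have "cofactor M 0 0 = monom 1 (2 * p)"
  proof -
    let ?N = "mat_delete M 0 0"
    have N: "?N \<in> carrier_mat (2 * p) (2 * p)" using M by (simp add: mat_delete_def)
    have Ne: "?N $$ (i, j) = M $$ (Suc i, Suc j)" if "i < 2 * p" "j < 2 * p" for i j
      using that M by (simp add: mat_delete_def)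
    have "det ?N = prod_list (diag_mat ?N)"
      using p by (intro det_lower_triangular[OF _ N]) (auto simp: Ne entry hub_mat_def)
    also have "\<dots> = (\<Prod>i\<in>{0..<2 * p}. ?N $$ (i, i))"
      using prod_list_diag_prod[of ?N] carrier_matD(1)[OF N] by metis
    also have "\<dots> = (\<Prod>i\<in>{0..<2 * p}. monom 1 1)"
      using p by (intro prod.cong) (auto simp: Ne entry hub_mat_def)
    finally show ?thesis by (simp add: cofactor_def monom_power)
  qed
  ultimately have "det M * monom 1 (p - 1) = (monom 1 (2 * p + 1) - monom a (p + 1)) * monom 1 (p - 1)"
    using p by (simp add: u_def algebra_simps mult_monom smult_monom flip: monom_0 mult_2_right)
  thus ?thesis unfolding M_def char_poly_def by simp
qed

lemma irreducible_hub_mat: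
  assumes p: "p \<ge> 3" and a: "a \<noteq> 0"
  shows "irreducible_mat (hub_mat p a)"
proof -
  let ?n = "2 * p + 1"
  have A: "hub_mat p a \<in> carrier_mat ?n ?n" by (simp add: hub_mat_def)
  show ?thesis unfolding irreducible_mat_iff[OF A]
  proof (intro allI impI, rule ccontr)
    fix W assume W: "W \<subseteq> {..<?n}" "W \<noteq> {}" "W \<noteq> {..<?n}"
      and "\<not> (\<exists>i\<in>W. \<exists>j\<in>{..<?n} - W. hub_mat p a $$ (i, j) \<noteq> 0)"
    hence closed: "j \<in> W" if "i \<in> W" "j < ?n" "hub_mat p a $$ (i, j) \<noteq> 0" for i j
      using that by blast
    have chain: "i - d \<in> W" if "i \<in> W" "i < p - 1" for i d
    proof (induction d)
      case (Suc d)
      show ?case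
      proof (cases "i - d = 0")
        case False
        thus ?thesis using closed[OF Suc, of "i - Suc d"] that p by (auto simp: hub_mat_def)
      qed (use Suc in auto)
    qed (use that in auto)
    have dup: "p - 2 \<in> W" if "i \<in> W" "p - 1 \<le> i" for i
    proof -
      have "i < ?n" using that W by auto
      hence "hub_mat p a $$ (i, p - 2) \<noteq> 0" using that p a by (auto simp: hub_mat_def)
      thus ?thesis using closed[OF that(1), of "p - 2"] by simp
    qed
    obtain i where i: "i \<in> W" using W by auto
    have "0 \<in> W"
      using chain[OF i, of i] dup[OF i] chain[of "p - 2" "p - 2"] p by (cases "i < p - 1") auto
    hence top: "j \<in> W" if "p - 1 \<le> j" "j < ?n" for j
      using closed[of 0 j] that by (auto simp: hub_mat_def)
    hence "p - 2 \<in> W" using dup[of p] p by auto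
    hence "j \<in> W" if "j < p - 1" for j
      using chain[of "p - 2" "p - 2 - j"] that p diff_diff_cancel[of j "p - 2"] by simp
    hence "W = {..<?n}" using top W(1) by (metis lessThan_iff not_less subsetI subset_antisym)
    thus False using W by simp
  qed
qed

lemma hub_realization:
  assumes p: "p \<ge> 3" and kp: "k p < 0" and k0: "\<And>j. p < j \<Longrightarrow> j \<le> 2 * p + 1 \<Longrightarrow> k j = 0"
  shows "irreducibly_realizable (gap_poly p k)"
proof -
  have "(\<Sum>j = p..2 * p + 1. monom (k j) (2 * p + 1 - j)) = (\<Sum>j\<in>{p}. monom (k j) (2 * p + 1 - j))"
    using p k0 by (intro sum.mono_neutral_right) auto
  also have "\<dots> = - monom (- k p) (p + 1)" using p by (simp add: minus_monom)
  finally have "char_poly (hub_mat p (- k p)) = gap_poly p k"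
    using p by (simp add: char_poly_hub_mat gap_poly_def)
  moreover have "nonneg_mat (hub_mat p (- k p))"
    using kp by (auto simp: nonneg_mat_def hub_mat_def divide_nonpos_nonneg)
  moreover have "irreducible_mat (hub_mat p (- k p))" using irreducible_hub_mat[OF p] kp by simp
  moreover have "hub_mat p (- k p) \<in> carrier_mat (2 * p + 1) (2 * p + 1)" by (simp add: hub_mat_def)
  ultimately show ?thesis using p unfolding irreducibly_realizable_def
    by (intro bexI[of _ "hub_mat p (- k p)"]) (auto simp: degree_gap_poly)
qed

section \<open>Sufficiency of the inequalities\<close>

text \<open>The larger root \<open>t\<close> of \<open>t * (- k p - t) = k (2 * p)\<close>, capped at \<open>- k p\<close>.\<close>

definition extremal_weight :: "nat \<Rightarrow> (nat \<Rightarrow> real) \<Rightarrow> real" where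
  "extremal_weight p k =
     (if k (2 * p) \<le> 0 then - k p else - k p / 2 + sqrt ((k p)\<^sup>2 / 4 - k (2 * p)))"

lemma extremal_weight:
  assumes kp: "k p \<le> 0" and k2p: "k (2 * p) \<le> (k p)\<^sup>2 / 4"
  defines "t \<equiv> extremal_weight p k"
  shows "0 \<le> t" "t \<le> - k p" "t * (- k p - t) = max 0 (k (2 * p))"
proof -
  define r where "r = sqrt ((k p)\<^sup>2 / 4 - k (2 * p))"
  have r: "0 \<le> r" "r\<^sup>2 = (k p)\<^sup>2 / 4 - k (2 * p)" using k2p by (simp_all add: r_def)
  show "0 \<le> t" using kp r by (simp add: t_def extremal_weight_def flip: r_def)
  have "r \<le> - k p / 2" if "k (2 * p) > 0"
    by (rule power2_le_imp_le) (use that kp r in \<open>auto simp: power2_eq_square\<close>)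
  thus "t \<le> - k p" by (auto simp: t_def extremal_weight_def simp flip: r_def)
  show "t * (- k p - t) = max 0 (k (2 * p))"
  proof (cases "k (2 * p) \<le> 0")
    case False
    hence te: "t = - k p / 2 + r" by (simp add: t_def extremal_weight_def r_def)
    have "t * (- k p - t) = (k p)\<^sup>2 / 4 - r\<^sup>2" unfolding te by (simp add: power2_eq_square algebra_simps)
    thus ?thesis using False r(2) by simp
  qed (simp add: t_def extremal_weight_def)
qed

text \<open>The extremal model has \<open>p\<close>-cycles of weight \<open>\<alpha> - t\<close> at
  0 and \<open>t\<close> at \<open>p + 1\<close>, and all of \<beta> on the
  \<open>(p + 1)\<close>-cycle at 0, the one disjoint from the heavier \<open>p\<close>-cycle. Any
  slack becomes linking longer cycles. Without slack all coefficients are determined by \<alpha>,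
  \<beta> and \<open>t\<close>, and their special values are treated separately.\<close>

lemma irreducibly_realizable_gap_poly:
  assumes p: "p \<ge> 3"
    and nonpos: "\<And>l. p \<le> l \<Longrightarrow> l < 2 * p \<Longrightarrow> k l \<le> 0"
    and k2p: "k (2 * p) \<le> (k p)\<^sup>2 / 4"
    and k2p1: "k (2 * p + 1) \<le> - k (p + 1) * extremal_weight p k"
    and not_case: "\<not> (case1 p k \<or> case2 p k \<or> case3 p k)"
    and nz: "\<exists>j\<in>{p..2 * p + 1}. k j \<noteq> 0"
  shows "irreducibly_realizable (gap_poly p k)"
proof -
  define \<alpha> \<beta> t where "\<alpha> = - k p" and "\<beta> = - k (p + 1)" and "t = extremal_weight p k"
  have \<alpha>: "0 \<le> \<alpha>" and \<beta>: "0 \<le> \<beta>" using nonpos[of p] nonpos[of "p + 1"] p by (auto simp: \<alpha>_def \<beta>_def)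
  have t: "0 \<le> t" "t \<le> \<alpha>" "t * (\<alpha> - t) = max 0 (k (2 * p))"
    using extremal_weight[OF _ k2p] \<alpha> by (auto simp: t_def \<alpha>_def)
  have b: "k (2 * p + 1) \<le> t * \<beta>" using k2p1 by (simp add: \<beta>_def t_def mult_ac)
  have "k (2 * p) \<le> t * (\<alpha> - t)" using t by simp
  note main = interval_realization[where x\<^sub>0 = "\<alpha> - t" and x\<^sub>2 = 0 and x\<^sub>1 = t and y\<^sub>0 = \<beta> and y\<^sub>1 = 0 and k = k, OF p]
  define slack where "slack \<longleftrightarrow> (\<exists>l. p + 2 \<le> l \<and> l < 2 * p \<and> k l < 0) \<or> k (2 * p) < t * (\<alpha> - t) \<or> k (2 * p + 1) < t * \<beta>"
  show ?thesis
  proof (cases slack)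
    case True
    show ?thesis
    proof (rule main)
      show "(\<exists>l. p + 2 \<le> l \<and> l < 2 * p \<and> k l < 0) \<or> k (2 * p) < t * (\<alpha> - t) \<or>
          k (2 * p + 1) < 0 * (\<alpha> - t) + t * \<beta> \<or> 0 < \<beta> \<and> (0 :: real) < 0 \<or> 0 < \<alpha> - t \<and> (0 :: real) < 0 \<and> 0 < t"
        using True unfolding slack_def by simp
      show "k l \<le> 0" if "p + 2 \<le> l" "l < 2 * p" for l using nonpos[of l] that by simp
    qed (use t \<beta> b \<open>k (2 * p) \<le> t * (\<alpha> - t)\<close> in \<open>simp_all add: \<alpha>_def \<beta>_def\<close>)
  next
    case False
    have zero: "k l = 0" if "p + 2 \<le> l" "l < 2 * p" for l
    proof -
      have "\<not> k l < 0" using False that unfolding slack_def by blast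
      thus ?thesis using nonpos[of l] that by simp
    qed
    have tight: "k (2 * p) = t * (\<alpha> - t)" "k (2 * p + 1) = t * \<beta>"
      using False b \<open>k (2 * p) \<le> t * (\<alpha> - t)\<close> unfolding slack_def by linarith+
    have a0: "0 \<le> k (2 * p)" using t tight by simp
    have a: "k (2 * p) \<le> \<alpha>\<^sup>2 / 4" using k2p by (simp add: \<alpha>_def)
    \<comment> \<open>With equal \<open>p\<close>-cycles the products do not depend on the side that
      carries \<beta>; halving it yields two \<open>(p + 1)\<close>-cycles that share vertex
      \<open>p\<close> and together cover all vertices.\<close>
    have balanced: ?thesis if "0 < \<beta>" "t = \<alpha> / 2"
    proof (rule interval_realization[where x\<^sub>0 = "\<alpha> / 2" and x\<^sub>2 = 0 and x\<^sub>1 = "\<alpha> / 2" and y\<^sub>0 = "\<beta> / 2" and y\<^sub>1 = "\<beta> / 2", OF p])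
      show "k (2 * p) \<le> \<alpha> / 2 * (\<alpha> / 2)" using a by (simp add: power2_eq_square)
      show "k l \<le> 0" if "p + 2 \<le> l" "l < 2 * p" for l using nonpos[of l] that by simp
      show "k (2 * p + 1) \<le> \<beta> / 2 * (\<alpha> / 2) + \<alpha> / 2 * (\<beta> / 2)" using b that by (simp add: mult_ac)
    qed (use that \<alpha> \<beta> in \<open>simp_all add: \<alpha>_def \<beta>_def\<close>)
    show ?thesis
    proof (cases "k (2 * p) = 0")
      case True
      hence t\<alpha>: "t = \<alpha>" by (simp add: t_def extremal_weight_def \<alpha>_def)
      show ?thesis
      proof (cases "\<alpha> = 0")
        case True
        have "\<beta> \<noteq> 0"
        proof
          assume "\<beta> = 0"
          hence "k j = 0" if "j \<in> {p..2 * p + 1}" for j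
          proof -
            have "j = p \<or> j = p + 1 \<or> (p + 2 \<le> j \<and> j < 2 * p) \<or> j = 2 * p \<or> j = 2 * p + 1" using that by auto
            moreover have "k p = 0" "k (p + 1) = 0" "k (2 * p + 1) = 0"
              using True \<open>\<beta> = 0\<close> tight(2) by (simp_all add: \<alpha>_def \<beta>_def)
            ultimately show ?thesis using zero[of j] \<open>k (2 * p) = 0\<close> by metis
          qed
          thus False using nz by auto
        qed
        \<comment> \<open>Here \<open>t = \<alpha> = 0\<close>, so \<open>t = \<alpha> / 2\<close>
          holds trivially.\<close>
        thus ?thesis using balanced \<beta> True t\<alpha> by auto
      next
        case False
        hence \<alpha>p: "0 < \<alpha>" using \<alpha> by simp
        have z: "\<forall>j\<in>{p + 2..2 * p}. k j = 0" using zero \<open>k (2 * p) = 0\<close> by (metis atLeastAtMost_iff le_neq_implies_less)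
        show ?thesis
        proof (cases "\<beta> = 0")
          case True
          have "k j = 0" if "p < j" "j \<le> 2 * p + 1" for j
          proof -
            have "j = p + 1 \<or> j \<in> {p + 2..2 * p} \<or> j = 2 * p + 1" using that by auto
            moreover have "k (p + 1) = 0" "k (2 * p + 1) = 0" using True tight(2) by (simp_all add: \<beta>_def)
            ultimately show ?thesis using z by metis
          qed
          moreover have "k p < 0" using \<alpha>p by (simp add: \<alpha>_def)
          ultimately show ?thesis by (intro hub_realization[OF p])
        next
          case False
          hence "case1 p k" unfolding case1_def using \<beta> \<alpha>p z tight(2) t\<alpha> by (simp add: \<alpha>_def \<beta>_def)
          thus ?thesis using not_case by simp
        qed
      qed
    next
      case False
      hence apos: "0 < k (2 * p)" using a0 by simp
      hence te: "t = \<alpha> / 2 + sqrt (\<alpha>\<^sup>2 / 4 - k (2 * p))" by (simp add: t_def extremal_weight_def \<alpha>_def)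
      have "\<alpha> \<noteq> 0" using apos a by auto
      hence \<alpha>p: "0 < \<alpha>" using \<alpha> by simp
      have z: "\<forall>j\<in>{p + 2..2 * p - 1}. k j = 0" using zero p by auto
      show ?thesis
      proof (cases "\<beta> = 0")
        case \<beta>0: True
        show ?thesis
        proof (cases "k (2 * p) = \<alpha>\<^sup>2 / 4")
          case True
          have "k j = 0" if "j \<in> {p + 1..2 * p - 1}" for j
          proof -
            have "j = p + 1 \<or> j \<in> {p + 2..2 * p - 1}" using that by auto
            moreover have "k (p + 1) = 0" using \<beta>0 by (simp add: \<beta>_def)
            ultimately show ?thesis using z by metis
          qed
          hence "case3 p k" unfolding case3_def using \<alpha>p True \<beta>0 tight(2) by (simp add: \<alpha>_def)
          thus ?thesis using not_case by simp
        next
          case False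
          \<comment> \<open>Equal outer weights produce \<open>k (2 * p)\<close> with the least
            total weight; the positive remainder \<open>\<alpha> - 2 * q\<close> goes to the middle
            \<open>p\<close>-cycle that links them.\<close>
          define q where "q = sqrt (k (2 * p))"
          have q: "0 < q" "q * q = k (2 * p)" using apos by (auto simp: q_def)
          have "2 * q < \<alpha>"
            by (rule power2_less_imp_less) (use False a q \<alpha> in \<open>auto simp: power2_eq_square\<close>)
          show ?thesis
          proof (rule interval_realization[where x\<^sub>0 = q and x\<^sub>2 = "\<alpha> - 2 * q" and x\<^sub>1 = q and y\<^sub>0 = 0 and y\<^sub>1 = 0, OF p])
            show "k l \<le> 0" if "p + 2 \<le> l" "l < 2 * p" for l using nonpos[of l] that by simp
          qed (use q \<open>2 * q < \<alpha>\<close> \<beta>0 tight(2) in \<open>simp_all add: \<alpha>_def \<beta>_def\<close>)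
        qed
      next
        case False
        hence \<beta>p: "0 < \<beta>" using \<beta> by simp
        show ?thesis
        proof (cases "k (2 * p) = \<alpha>\<^sup>2 / 4")
          case True
          hence "t = \<alpha> / 2" using te by simp
          thus ?thesis using balanced \<beta>p by simp
        next
          case False
          have "case2 p k" unfolding case2_def
          proof (intro conjI)
            show "k (2 * p + 1) = k (p + 1) * (k p / 2 - sqrt ((k p)\<^sup>2 / 4 - k (2 * p)))"
              using tight(2) te by (simp add: \<alpha>_def \<beta>_def algebra_simps)
            show "k (2 * p) < (k p)\<^sup>2 / 4" using False a by (simp add: \<alpha>_def)
          qed (use \<alpha>p \<beta>p z apos in \<open>auto simp: \<alpha>_def \<beta>_def\<close>)
          thus ?thesis using not_case by simp
        qed
      qed
    qed
  qed
qed

section \<open>Weights of disjoint cycles\<close>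

text \<open>\<open>w T\<close> stands for the total weight of the cycles with vertex set \<open>T\<close>.\<close>

locale cycle_weights =
  fixes p :: nat and w :: "nat set \<Rightarrow> real"
  assumes p: "p \<ge> 2" and w_nonneg: "0 \<le> w T"
begin

abbreviation "V \<equiv> {..<2 * p + 1}"
definition "\<P> = {T. T \<subseteq> V \<and> card T = p}"
definition "\<C> = {T. T \<subseteq> V \<and> card T = p + 1}"
definition "\<alpha> = (\<Sum>T\<in>\<P>. w T)"
definition "\<beta> = (\<Sum>T\<in>\<C>. w T)"
definition "disjoint_pairs = (\<Sum>T\<in>\<P>. \<Sum>T'\<in>\<P>. if T \<inter> T' = {} then w T * w T' else 0) / 2"
definition "complementary_pairs = (\<Sum>T\<in>\<C>. w T * w (V - T))"
definition "intersecting F \<longleftrightarrow> F \<subseteq> \<P> \<and> (\<forall>T\<in>F. \<forall>T'\<in>F. T \<inter> T' \<noteq> {})"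
definition "max_weight = Max (sum w ` {F. intersecting F})"

lemma finite_P: "finite \<P>" and finite_C: "finite \<C>"
  unfolding \<P>_def \<C>_def by (auto intro: finite_subset[of _ "Pow V"])

lemma intersecting_weight_le:
  assumes "intersecting F"
  shows "sum w F \<le> max_weight"
  unfolding max_weight_def
proof (rule Max_ge)
  have "{F. intersecting F} \<subseteq> Pow \<P>" by (auto simp: intersecting_def)
  thus "finite (sum w ` {F. intersecting F})" using finite_P by (meson finite_Pow_iff finite_imageI finite_subset)
qed (use assms in auto)

lemma max_weight_family:
  obtains I where "intersecting I" "sum w I = max_weight"
proof -
  have "{F. intersecting F} \<subseteq> Pow \<P>" by (auto simp: intersecting_def)
  hence "finite (sum w ` {F. intersecting F})" using finite_P by (meson finite_Pow_iff finite_imageI finite_subset)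
  moreover have "{} \<in> {F. intersecting F}" by (auto simp: intersecting_def)
  ultimately have "max_weight \<in> sum w ` {F. intersecting F}"
    unfolding max_weight_def by (intro Max_in) auto
  thus ?thesis using that by auto
qed

lemma singleton_weight_le: "T \<in> \<P> \<Longrightarrow> w T \<le> max_weight"
proof -
  assume T: "T \<in> \<P>"
  hence "T \<noteq> {}" using p by (auto simp: \<P>_def)
  thus ?thesis using intersecting_weight_le[of "{T}"] T by (auto simp: intersecting_def)
qed

text \<open>The weighted degree of \<open>T\<close> in the disjointness graph.\<close>

definition "disjoint_weight T = (\<Sum>T'\<in>\<P>. if T \<inter> T' = {} then w T' else 0)"

text \<open>The \<open>p\<close>-sets avoiding \<open>T\<close> meet pairwise, since three disjoint
  ones would need \<open>3 * p\<close> vertices; so they are one of the families over which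
  \<open>max_weight\<close> is taken.\<close>

lemma disjoint_weight_le:
  assumes "T \<in> \<P>"
  shows "disjoint_weight T \<le> max_weight"
proof -
  have "T' \<inter> T'' \<noteq> {}" if "T' \<in> \<P>" "T'' \<in> \<P>" "T \<inter> T' = {}" "T \<inter> T'' = {}" for T' T''
  proof
    assume d: "T' \<inter> T'' = {}"
    have fin: "finite T" "finite T'" "finite T''" using assms that by (auto simp: \<P>_def intro: finite_subset)
    have "card (T \<union> T' \<union> T'') = 3 * p"
      using fin d that assms by (subst card_Un_disjoint; (subst card_Un_disjoint)?) (auto simp: \<P>_def)
    moreover have "card (T \<union> T' \<union> T'') \<le> card V" using assms that by (intro card_mono) (auto simp: \<P>_def)
    ultimately show False using p by simp
  qed
  hence "intersecting {T' \<in> \<P>. T \<inter> T' = {}}" by (auto simp: intersecting_def)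
  from intersecting_weight_le[OF this] show ?thesis
    unfolding disjoint_weight_def using finite_P by (simp add: sum.inter_filter)
qed

text \<open>Mantel's theorem for weighted graphs, applied to the disjointness graph of the \<open>p\<close>-sets, which
  is triangle-free because \<open>3 * p > 2 * p + 1\<close>. The two extra terms on the left are nonnegative
  and vanish in the extremal cases.\<close>

lemma disjoint_pairs_defect:
  assumes I: "intersecting I" "sum w I = max_weight"
  shows "disjoint_pairs + (\<Sum>T\<in>\<P> - I. \<Sum>T'\<in>\<P> - I. if T \<inter> T' = {} then w T * w T' else 0) / 2 +
    (\<Sum>T\<in>\<P> - I. w T * (max_weight - disjoint_weight T)) = max_weight * (\<alpha> - max_weight)"
proof -
  define f where "f T T' = (if T \<inter> T' = {} then w T * w T' else 0)" for T T'
  define S where "S X Y = (\<Sum>T\<in>X. \<Sum>T'\<in>Y. f T T')" for X Y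
  have IP: "I \<subseteq> \<P>" using I by (simp add: intersecting_def)
  have split: "sum h \<P> = sum h I + sum h (\<P> - I)" for h :: "nat set \<Rightarrow> real"
    using sum.subset_diff[OF IP finite_P, of h] by simp
  \<comment> \<open>There are no disjoint pairs inside \<open>I\<close>. The degrees outside
    \<open>I\<close> count each mixed pair once and each outside pair twice; the first extra term
    supplies the second count.\<close>
  have "S I I = 0" unfolding S_def f_def using I(1) by (intro sum.neutral) (auto simp: intersecting_def)
  moreover have "S I (\<P> - I) = S (\<P> - I) I"
    unfolding S_def f_def by (subst sum.swap) (auto simp: Int_commute mult.commute intro!: sum.cong)
  moreover have "2 * disjoint_pairs = S I I + S I (\<P> - I) + S (\<P> - I) I + S (\<P> - I) (\<P> - I)"
    unfolding disjoint_pairs_def S_def f_def[symmetric] by (simp add: split sum.distrib)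
  moreover have "(\<Sum>T\<in>\<P> - I. w T * disjoint_weight T) = S (\<P> - I) I + S (\<P> - I) (\<P> - I)"
  proof -
    have "w T * disjoint_weight T = sum (f T) I + sum (f T) (\<P> - I)" for T
      unfolding split[symmetric] disjoint_weight_def f_def sum_distrib_left by (intro sum.cong) auto
    thus ?thesis by (simp add: S_def sum.distrib)
  qed
  moreover have "\<alpha> = max_weight + sum w (\<P> - I)" using I(2) split[of w] by (simp add: \<alpha>_def)
  moreover have "(\<Sum>T\<in>\<P> - I. w T * (max_weight - disjoint_weight T)) =
     max_weight * sum w (\<P> - I) - (\<Sum>T\<in>\<P> - I. w T * disjoint_weight T)"
    by (simp add: algebra_simps sum_subtractf sum_distrib_left)
  ultimately show ?thesis unfolding f_def[symmetric] S_def[symmetric] by (simp add: algebra_simps)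
qed

lemma max_weight_le: "max_weight \<le> \<alpha>"
proof -
  obtain I where I: "intersecting I" "sum w I = max_weight" by (rule max_weight_family)
  have "sum w I \<le> sum w \<P>" using I finite_P w_nonneg by (intro sum_mono2) (auto simp: intersecting_def)
  thus ?thesis using I by (simp add: \<alpha>_def)
qed

lemma disjoint_pairs_le: "disjoint_pairs \<le> max_weight * (\<alpha> - max_weight)"
proof -
  obtain I where I: "intersecting I" "sum w I = max_weight" by (rule max_weight_family)
  have "0 \<le> (\<Sum>T\<in>\<P> - I. \<Sum>T'\<in>\<P> - I. if T \<inter> T' = {} then w T * w T' else 0)"
    using w_nonneg by (intro sum_nonneg) auto
  moreover have "0 \<le> (\<Sum>T\<in>\<P> - I. w T * (max_weight - disjoint_weight T))"
    using w_nonneg disjoint_weight_le by (intro sum_nonneg mult_nonneg_nonneg) auto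
  ultimately show ?thesis using disjoint_pairs_defect[OF I] by linarith
qed

lemma complement_mem_P: "T \<in> \<C> \<Longrightarrow> V - T \<in> \<P>"
proof -
  assume "T \<in> \<C>"
  hence T: "T \<subseteq> V" "card T = p + 1" by (auto simp: \<C>_def)
  hence "card (V - T) = p" using finite_subset[OF T(1)] by (subst card_Diff_subset) auto
  thus ?thesis by (auto simp: \<P>_def)
qed

lemma complementary_pairs_le: "complementary_pairs \<le> \<beta> * max_weight"
  unfolding complementary_pairs_def \<beta>_def sum_distrib_right
  using complement_mem_P singleton_weight_le w_nonneg by (intro sum_mono mult_left_mono) auto

text \<open>\<open>U\<close> is the union of the positive members of a heaviest intersecting family
  \<open>I\<close>. Equality annihilates both defect terms, so a positive \<open>p\<close>-set
  outside \<open>I\<close> avoids every positive member of \<open>I\<close>, hence \<open>U\<close>.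
  If a \<open>(p + 1)\<close>-set \<open>C\<close> is positive, equality in the other bound puts the
  whole \<open>max_weight\<close> on the single set \<open>V - C\<close>, and this forces
  \<open>U = V - C\<close>.\<close>

lemma extremal_split:
  assumes pairs: "disjoint_pairs = max_weight * (\<alpha> - max_weight)"
    and compl: "complementary_pairs = \<beta> * max_weight"
    and s: "0 < max_weight" "\<alpha> \<le> 2 * max_weight"
    and s': "(\<alpha> < 2 * max_weight \<and> 0 < \<beta>) \<or> (max_weight < \<alpha> \<and> \<beta> = 0)"
  shows "\<exists>U. U \<subseteq> V \<and> U \<noteq> {} \<and> U \<noteq> V \<and>
    (\<forall>T\<in>\<P> \<union> \<C>. 0 < w T \<longrightarrow> T \<subseteq> U \<or> T \<inter> U = {})"
proof -
  obtain I where I: "intersecting I" "sum w I = max_weight" by (rule max_weight_family)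
  have IP: "I \<subseteq> \<P>" using I by (simp add: intersecting_def)
  have finI: "finite I" using IP finite_P finite_subset by blast
  define Q where "Q = (\<Sum>T\<in>\<P> - I. \<Sum>T'\<in>\<P> - I. if T \<inter> T' = {} then w T * w T' else 0)"
  define R where "R = (\<Sum>T\<in>\<P> - I. w T * (max_weight - disjoint_weight T))"
  have Q0: "0 \<le> Q" unfolding Q_def using w_nonneg by (intro sum_nonneg) auto
  have R0: "0 \<le> R" unfolding R_def using w_nonneg disjoint_weight_le
    by (intro sum_nonneg mult_nonneg_nonneg) auto
  have QR: "Q = 0" "R = 0" using disjoint_pairs_defect[OF I] pairs Q0 R0 unfolding Q_def R_def by linarith+
  have finPI: "finite (\<P> - I)" using finite_P by simp
  have full: "disjoint_weight T = max_weight" if "T \<in> \<P> - I" "0 < w T" for T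
  proof -
    have "w T * (max_weight - disjoint_weight T) = 0"
      by (rule sum_nonneg_0[OF finPI _ QR(2)[unfolded R_def] that(1)])
        (use w_nonneg disjoint_weight_le in auto)
    thus ?thesis using that by simp
  qed
  have indep: "T \<inter> T' \<noteq> {}" if T: "T \<in> \<P> - I" "0 < w T" and T': "T' \<in> \<P> - I" "0 < w T'" for T T'
  proof
    assume "T \<inter> T' = {}"
    have "(\<Sum>T'\<in>\<P> - I. if T \<inter> T' = {} then w T * w T' else 0) = 0"
      by (rule sum_nonneg_0[OF finPI _ QR(1)[unfolded Q_def] T(1)])
        (use w_nonneg in \<open>auto intro!: sum_nonneg\<close>)
    hence "(if T \<inter> T' = {} then w T * w T' else 0) = 0"
      by (rule sum_nonneg_0[OF finPI _ _ T'(1), rotated]) (use w_nonneg in auto)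
    thus False using T T' \<open>T \<inter> T' = {}\<close> by simp
  qed
  \<comment> \<open>Positive sets outside \<open>I\<close> meet each other, so the full degree of
    \<open>T\<close> comes from \<open>I\<close> alone; as it equals \<open>sum w I\<close>, no
    positive member of \<open>I\<close> can meet \<open>T\<close>.\<close>
  have cross: "T \<inter> T' = {}" if T: "T \<in> \<P> - I" "0 < w T" and T': "T' \<in> I" "0 < w T'" for T T'
  proof -
    have "disjoint_weight T = (\<Sum>T'\<in>I. if T \<inter> T' = {} then w T' else 0) +
        (\<Sum>T'\<in>\<P> - I. if T \<inter> T' = {} then w T' else 0)"
      unfolding disjoint_weight_def using sum.subset_diff[OF IP finite_P] by (simp add: add.commute)
    also have "(\<Sum>T'\<in>\<P> - I. if T \<inter> T' = {} then w T' else 0) = 0"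
      using indep[OF T] w_nonneg by (intro sum.neutral) (metis less_le)
    finally have "(\<Sum>T'\<in>I. w T' - (if T \<inter> T' = {} then w T' else 0)) = 0"
      using full[OF T] I(2) by (simp add: sum_subtractf)
    hence "w T' - (if T \<inter> T' = {} then w T' else 0) = 0"
      by (rule sum_nonneg_0[OF finI _ _ T'(1), rotated]) (use w_nonneg in auto)
    thus ?thesis using T' by (auto split: if_splits)
  qed
  define U where "U = \<Union>{T \<in> I. 0 < w T}"
  have UV: "U \<subseteq> V" unfolding U_def using IP by (auto simp: \<P>_def)
  have "\<exists>T\<in>I. 0 < w T"
  proof (rule ccontr)
    assume "\<not> (\<exists>T\<in>I. 0 < w T)"
    hence "sum w I \<le> 0" by (intro sum_nonpos) (auto simp: not_less)
    thus False using I s by simp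
  qed
  then obtain T0 where T0: "T0 \<in> I" "0 < w T0" by blast
  have ne: "T \<noteq> {}" if "T \<in> \<P>" for T using that p by (auto simp: \<P>_def)
  have "U \<noteq> {}" unfolding U_def using T0 ne IP by blast
  have splitP: "T \<subseteq> U \<or> T \<inter> U = {}" if "T \<in> \<P>" "0 < w T" for T
    using cross[of T] that unfolding U_def by (cases "T \<in> I") auto
  have complU: "U = V - C" if C: "C \<in> \<C>" "0 < w C" for C
  proof -
    have "(\<Sum>T\<in>\<C>. w T * (max_weight - w (V - T))) = 0"
      using compl unfolding complementary_pairs_def \<beta>_def
      by (simp add: right_diff_distrib sum_subtractf sum_distrib_right)
    hence "w C * (max_weight - w (V - C)) = 0"
      by (rule sum_nonneg_0[OF finite_C _ _ C(1), rotated])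
        (use w_nonneg singleton_weight_le complement_mem_P in auto)
    hence wC: "w (V - C) = max_weight" using C by simp
    have CP: "V - C \<in> \<P>" using complement_mem_P C by auto
    have "0 < \<beta>" unfolding \<beta>_def using sum_pos2[OF finite_C C(1), of w] C(2) w_nonneg by simp
    hence lt: "\<alpha> < 2 * max_weight" using s' by auto
    \<comment> \<open>Otherwise \<open>I\<close> and \<open>V - C\<close> together would weigh
      \<open>2 * max_weight\<close>, more than \<alpha>.\<close>
    have "V - C \<in> I"
    proof (rule ccontr)
      assume "V - C \<notin> I"
      have "sum w I + w (V - C) = sum w (insert (V - C) I)" using \<open>V - C \<notin> I\<close> finI by simp
      also have "\<dots> \<le> \<alpha>" unfolding \<alpha>_def using CP IP finite_P w_nonneg by (intro sum_mono2) auto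
      finally show False using lt I wC by simp
    qed
    hence "sum w I = w (V - C) + sum w (I - {V - C})" using finI by (simp add: sum.remove)
    hence "sum w (I - {V - C}) = 0" using I wC by simp
    hence "w T = 0" if "T \<in> I - {V - C}" for T
      by (rule sum_nonneg_0[OF _ _ _ that, rotated 2]) (use finI w_nonneg in auto)
    hence "{T \<in> I. 0 < w T} = {V - C}" using \<open>V - C \<in> I\<close> wC s(1) by force
    thus ?thesis unfolding U_def by simp
  qed
  \<comment> \<open>A positive \<open>(p + 1)\<close>-set avoids \<open>U\<close>; for \<beta> = 0 a
    positive \<open>p\<close>-set outside \<open>I\<close> does, and it exists because
    \<open>max_weight < \<alpha>\<close>.\<close>
  have "U \<noteq> V"
  proof (cases "0 < \<beta>")
    case True
    have "\<exists>C\<in>\<C>. 0 < w C"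
    proof (rule ccontr)
      assume "\<not> (\<exists>C\<in>\<C>. 0 < w C)"
      hence "\<beta> \<le> 0" unfolding \<beta>_def by (intro sum_nonpos) (auto simp: not_less)
      thus False using True by simp
    qed
    then obtain C where C: "C \<in> \<C>" "0 < w C" by blast
    have "C \<noteq> {}" "C \<subseteq> V" using C by (auto simp: \<C>_def)
    thus ?thesis using complU[OF C] by blast
  next
    case False
    hence lt: "max_weight < \<alpha>" using s' by simp
    have "\<exists>T\<in>\<P> - I. 0 < w T"
    proof (rule ccontr)
      assume "\<not> (\<exists>T\<in>\<P> - I. 0 < w T)"
      hence "sum w (\<P> - I) \<le> 0" by (intro sum_nonpos) (auto simp: not_less)
      hence "\<alpha> \<le> sum w I" unfolding \<alpha>_def using sum.subset_diff[OF IP finite_P, of w] by simp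
      thus False using lt I by simp
    qed
    then obtain T where T: "T \<in> \<P> - I" "0 < w T" by blast
    hence "T \<inter> U = {}" using cross[OF T] unfolding U_def by blast
    thus ?thesis using ne[of T] T by (auto simp: \<P>_def)
  qed
  moreover have "T \<subseteq> U \<or> T \<inter> U = {}" if "T \<in> \<P> \<union> \<C>" "0 < w T" for T
    using that(1)
  proof
    assume "T \<in> \<P>"
    thus ?thesis using splitP that(2) by simp
  next
    assume "T \<in> \<C>"
    thus ?thesis using complU[of T] that(2) by blast
  qed
  ultimately show ?thesis using UV \<open>U \<noteq> {}\<close> by (intro exI[of _ U]) simp
qed

end

section \<open>Cycle expansion of principal minors\<close>

text \<open>A singleton has the identity as its cycle, so diagonal entries count as loops; the empty
  set has no cycle.\<close>

definition cyclic_perms :: "'a set \<Rightarrow> ('a \<Rightarrow> 'a) set" where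
  "cyclic_perms T = {\<tau>. \<tau> permutes T \<and> cyclic_on \<tau> T}"

lemma sign_cycle_of_list: "distinct cs \<Longrightarrow> sign (cycle_of_list cs) = (- 1) ^ (length cs - 1)"
proof (induction cs rule: cycle_of_list.induct)
  case (1 i j cs)
  have "sign (cycle_of_list (i # j # cs)) = sign (Transposition.transpose i j) * sign (cycle_of_list (j # cs))"
    unfolding cycle_of_list.simps by (rule sign_compose[OF permutation_swap_id permutation_of_cycle])
  also have "\<dots> = (- 1) ^ (length (i # j # cs) - 1)" using 1 by (simp add: sign_swap_id)
  finally show ?case .
qed simp_all

lemma sign_cyclic_perm:
  assumes "\<tau> \<in> cyclic_perms T" "finite T"
  shows "sign \<tau> = (- 1) ^ (card T - 1)"
proof -
  have \<tau>: "\<tau> permutes T" "cyclic_on \<tau> T" using assms by (auto simp: cyclic_perms_def)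
  have perm: "permutation \<tau>" by (rule permutes_imp_permutation[OF assms(2) \<tau>(1)])
  obtain v where v: "v \<in> T" "T = orbit \<tau> v" using \<tau> by (auto simp: cyclic_on_def)
  let ?cs = "support \<tau> v"
  have dist: "distinct ?cs" by (rule cycle_of_permutation[OF perm])
  have set: "set ?cs = T"
    unfolding support_set[OF perm] v(2) orbit_altdef_permutation[OF perm] by auto
  have "\<tau> = cycle_of_list ?cs"
  proof
    fix x show "\<tau> x = cycle_of_list ?cs x"
    proof (cases "x \<in> T")
      case True
      thus ?thesis using cycle_restrict[OF perm, of x v] set by simp
    next
      case False
      thus ?thesis using id_outside_supp[of x ?cs] set permutes_not_in[OF \<tau>(1)] by metis
    qed
  qed
  moreover have "length ?cs = card T" using distinct_card[OF dist] set by simp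
  ultimately show ?thesis using sign_cycle_of_list[OF dist] by metis
qed

lemma perm_restrict_orbit_permutes:
  assumes "\<sigma> permutes S" "finite S"
  shows "perm_restrict \<sigma> (orbit \<sigma> v) permutes orbit \<sigma> v"
proof -
  have perm: "permutation \<sigma>" by (rule permutes_imp_permutation[OF assms(2,1)])
  have cyc: "cyclic_on \<sigma> (orbit \<sigma> v)" by (rule cyclic_on_orbit[OF assms])
  have inj: "inj_on \<sigma> (orbit \<sigma> v)" by (rule inj_on_subset[OF permutes_inj[OF assms(1)] subset_UNIV])
  have "\<sigma> ` orbit \<sigma> v = orbit \<sigma> v"
    by (rule endo_inj_surj[OF finite_cyclic_on[OF cyc] _ inj]) (auto intro: cyclic_on_inI[OF cyc])
  hence "bij_betw \<sigma> (orbit \<sigma> v) (orbit \<sigma> v)" using inj by (simp add: bij_betw_def)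
  hence "bij_betw (perm_restrict \<sigma> (orbit \<sigma> v)) (orbit \<sigma> v) (orbit \<sigma> v)"
    by (subst bij_betw_cong[of _ _ \<sigma>]) (auto simp: perm_restrict_def)
  thus ?thesis by (rule bij_imp_permutes) (auto simp: perm_restrict_def)
qed

text \<open>A permutation amounts to its cycle through \<open>v\<close> together with an arbitrary
  permutation of the points off that cycle.\<close>

lemma sum_permutations_by_orbit:
  fixes h :: "('a \<Rightarrow> 'a) \<Rightarrow> 'b :: comm_monoid_add"
  assumes S: "finite S" and v: "v \<in> S"
  shows "(\<Sum>\<sigma> | \<sigma> permutes S. h \<sigma>) =
    (\<Sum>T | v \<in> T \<and> T \<subseteq> S. \<Sum>\<tau>\<in>cyclic_perms T. \<Sum>\<rho> | \<rho> permutes (S - T). h (\<tau> \<circ> \<rho>))"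
proof -
  have fin: "finite {T. v \<in> T \<and> T \<subseteq> S}" using S by simp
  have finT: "finite (cyclic_perms T \<times> {\<rho>. \<rho> permutes (S - T)})" if "T \<subseteq> S" for T
  proof -
    have "finite {\<tau>. \<tau> permutes T}" "finite {\<rho>. \<rho> permutes (S - T)}"
      using that S finite_subset by (auto intro!: finite_permutations)
    thus ?thesis by (auto simp: cyclic_perms_def)
  qed
  have "(\<Sum>T | v \<in> T \<and> T \<subseteq> S. \<Sum>\<tau>\<in>cyclic_perms T. \<Sum>\<rho> | \<rho> permutes (S - T). h (\<tau> \<circ> \<rho>)) =
    (\<Sum>T | v \<in> T \<and> T \<subseteq> S. \<Sum>(\<tau>, \<rho>)\<in>cyclic_perms T \<times> {\<rho>. \<rho> permutes (S - T)}. h (\<tau> \<circ> \<rho>))"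
    by (simp add: sum.cartesian_product)
  also have "\<dots> = (\<Sum>(T, \<tau>, \<rho>)\<in>(SIGMA T:{T. v \<in> T \<and> T \<subseteq> S}. cyclic_perms T \<times> {\<rho>. \<rho> permutes (S - T)}). h (\<tau> \<circ> \<rho>))"
    using fin finT by (subst sum.Sigma) (auto simp: case_prod_unfold)
  also have "\<dots> = (\<Sum>\<sigma> | \<sigma> permutes S. h \<sigma>)"
  proof (rule sum.reindex_bij_witness[where j = "\<lambda>(T, \<tau>, \<rho>). \<tau> \<circ> \<rho>" and
      i = "\<lambda>\<sigma>. (orbit \<sigma> v, perm_restrict \<sigma> (orbit \<sigma> v), perm_restrict \<sigma> (S - orbit \<sigma> v))"])
    fix x assume "x \<in> (SIGMA T:{T. v \<in> T \<and> T \<subseteq> S}. cyclic_perms T \<times> {\<rho>. \<rho> permutes (S - T)})"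
    then obtain T \<tau> \<rho> where x: "x = (T, \<tau>, \<rho>)" and T: "v \<in> T" "T \<subseteq> S" and \<tau>: "\<tau> permutes T" "cyclic_on \<tau> T"
      and \<rho>: "\<rho> permutes (S - T)" by (auto simp: cyclic_perms_def)
    have "cyclic_on (\<tau> \<circ> \<rho>) T"
      by (rule permutes_comp_preserves_cyclic1[OF \<rho> \<tau>(2), of T]) auto
    hence orb: "orbit (\<tau> \<circ> \<rho>) v = T" using T by (intro orbit_cyclic_eq3)
    have r1: "perm_restrict (\<tau> \<circ> \<rho>) T = \<tau>"
      using permutes_not_in[OF \<tau>(1)] permutes_not_in[OF \<rho>] by (auto simp: perm_restrict_def fun_eq_iff)
    have r2: "perm_restrict (\<tau> \<circ> \<rho>) (S - T) = \<rho>"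
    proof
      fix y show "perm_restrict (\<tau> \<circ> \<rho>) (S - T) y = \<rho> y"
        using permutes_not_in[OF \<tau>(1), of "\<rho> y"] permutes_not_in[OF \<rho>, of y] permutes_in_image[OF \<rho>, of y]
        by (auto simp: perm_restrict_def)
    qed
    show "(\<lambda>\<sigma>. (orbit \<sigma> v, perm_restrict \<sigma> (orbit \<sigma> v), perm_restrict \<sigma> (S - orbit \<sigma> v)))
        ((\<lambda>(T, \<tau>, \<rho>). \<tau> \<circ> \<rho>) x) = x" using orb r1 r2 by (simp add: x)
    have "\<tau> \<circ> \<rho> permutes S"
      using permutes_subset[OF \<tau>(1) T(2)] permutes_subset[OF \<rho>, of S] by (intro permutes_compose) auto
    thus "(\<lambda>(T, \<tau>, \<rho>). \<tau> \<circ> \<rho>) x \<in> {\<sigma>. \<sigma> permutes S}" by (simp add: x)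
    show "h ((\<lambda>(T, \<tau>, \<rho>). \<tau> \<circ> \<rho>) x) = (\<lambda>(T, \<tau>, \<rho>). h (\<tau> \<circ> \<rho>)) x" by (simp add: x)
  next
    fix \<sigma> assume "\<sigma> \<in> {\<sigma>. \<sigma> permutes S}"
    hence \<sigma>: "\<sigma> permutes S" by simp
    let ?O = "orbit \<sigma> v"
    have cyc: "cyclic_on \<sigma> ?O" by (rule cyclic_on_orbit[OF \<sigma> S])
    have sub: "?O \<subseteq> S" by (rule permutes_orbit_subset[OF \<sigma> v])
    have vO: "v \<in> ?O" by (rule permutation_self_in_orbit[OF permutes_imp_permutation[OF S \<sigma>]])
    have p1: "perm_restrict \<sigma> ?O permutes ?O" by (rule perm_restrict_orbit_permutes[OF \<sigma> S])
    have p2: "perm_restrict \<sigma> (S - ?O) permutes (S - ?O)" by (rule perm_restrict_diff_cyclic[OF \<sigma> cyc])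
    have "perm_restrict \<sigma> ?O \<circ> perm_restrict \<sigma> (S - ?O) = perm_restrict \<sigma> (?O \<union> (S - ?O))"
      using p1 p2 by (rule perm_restrict_union) auto
    also have "?O \<union> (S - ?O) = S" using sub by auto
    finally have "perm_restrict \<sigma> ?O \<circ> perm_restrict \<sigma> (S - ?O) = \<sigma>"
      unfolding perm_restrict_id[OF \<sigma>] .
    thus "(\<lambda>(T, \<tau>, \<rho>). \<tau> \<circ> \<rho>) (?O, perm_restrict \<sigma> ?O, perm_restrict \<sigma> (S - ?O)) = \<sigma>"
      by (simp only: prod.case)
    show "(?O, perm_restrict \<sigma> ?O, perm_restrict \<sigma> (S - ?O))
        \<in> (SIGMA T:{T. v \<in> T \<and> T \<subseteq> S}. cyclic_perms T \<times> {\<rho>. \<rho> permutes (S - T)})"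
      using vO sub p1 p2 cyc by (simp add: cyclic_perms_def cyclic_on_perm_restrict)
  qed
  finally show ?thesis ..
qed

text \<open>The determinant of the principal submatrix of \<open>- a\<close> on the indices \<open>S\<close>.\<close>

definition neg_minor :: "('a \<Rightarrow> 'a \<Rightarrow> real) \<Rightarrow> 'a set \<Rightarrow> real" where
  "neg_minor a S = (\<Sum>\<sigma> | \<sigma> permutes S. of_int (sign \<sigma>) * (\<Prod>i\<in>S. - a i (\<sigma> i)))"

definition cycle_weight :: "('a \<Rightarrow> 'a \<Rightarrow> real) \<Rightarrow> 'a set \<Rightarrow> real" where
  "cycle_weight a T = (\<Sum>\<tau>\<in>cyclic_perms T. \<Prod>i\<in>T. a i (\<tau> i))"

lemma neg_minor_empty [simp]: "neg_minor a {} = 1"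
  by (simp add: neg_minor_def)

text \<open>A cycle of length \<open>l\<close> has sign \<open>(- 1) ^ (l - 1)\<close> and its
  negated entries contribute \<open>(- 1) ^ l\<close>, so splitting off the cycle through
  \<open>v\<close> costs one factor \<open>-1\<close> whatever its length.\<close>

lemma neg_minor_expand:
  assumes S: "finite S" and v: "v \<in> S"
  shows "neg_minor a S = - (\<Sum>T | v \<in> T \<and> T \<subseteq> S. cycle_weight a T * neg_minor a (S - T))"
proof -
  have "(\<Sum>\<tau>\<in>cyclic_perms T. \<Sum>\<rho> | \<rho> permutes (S - T). of_int (sign (\<tau> \<circ> \<rho>)) * (\<Prod>i\<in>S. - a i ((\<tau> \<circ> \<rho>) i)))
     = - (cycle_weight a T * neg_minor a (S - T))" if T: "v \<in> T" "T \<subseteq> S" for T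
  proof -
    have fin: "finite T" "finite (S - T)" using T S finite_subset by auto
    have "of_int (sign (\<tau> \<circ> \<rho>)) * (\<Prod>i\<in>S. - a i ((\<tau> \<circ> \<rho>) i)) =
        - (\<Prod>i\<in>T. a i (\<tau> i)) * (of_int (sign \<rho>) * (\<Prod>i\<in>S - T. - a i (\<rho> i)))"
      if \<tau>: "\<tau> \<in> cyclic_perms T" and \<rho>: "\<rho> permutes (S - T)" for \<tau> \<rho>
    proof -
      have \<tau>p: "\<tau> permutes T" using \<tau> by (simp add: cyclic_perms_def)
      have "permutation \<tau>" "permutation \<rho>" using permutes_imp_permutation \<tau>p \<rho> fin by auto
      hence s: "sign (\<tau> \<circ> \<rho>) = sign \<tau> * sign \<rho>" by (rule sign_compose)
      have "(\<Prod>i\<in>S. - a i ((\<tau> \<circ> \<rho>) i)) =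
          (\<Prod>i\<in>S - T. - a i ((\<tau> \<circ> \<rho>) i)) * (\<Prod>i\<in>T. - a i ((\<tau> \<circ> \<rho>) i))"
        by (rule prod.subset_diff[OF T(2) S])
      also have "(\<Prod>i\<in>S - T. - a i ((\<tau> \<circ> \<rho>) i)) = (\<Prod>i\<in>S - T. - a i (\<rho> i))"
      proof (rule prod.cong[OF refl])
        fix i assume "i \<in> S - T"
        hence "\<rho> i \<notin> T" using permutes_in_image[OF \<rho>, of i] by blast
        thus "- a i ((\<tau> \<circ> \<rho>) i) = - a i (\<rho> i)" by (simp add: permutes_not_in[OF \<tau>p])
      qed
      also have "(\<Prod>i\<in>T. - a i ((\<tau> \<circ> \<rho>) i)) = (\<Prod>i\<in>T. - a i (\<tau> i))"
        using permutes_not_in[OF \<rho>] by (intro prod.cong) auto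
      also have "\<dots> = (- 1) ^ card T * (\<Prod>i\<in>T. a i (\<tau> i))"
        by (rule prod_uminus)
      finally have "of_int (sign (\<tau> \<circ> \<rho>)) * (\<Prod>i\<in>S. - a i ((\<tau> \<circ> \<rho>) i)) =
        (of_int (sign \<tau>) * (- 1) ^ card T) * (\<Prod>i\<in>T. a i (\<tau> i)) * (of_int (sign \<rho>) * (\<Prod>i\<in>S - T. - a i (\<rho> i)))"
        by (simp add: s)
      moreover have "(of_int (sign \<tau>) * (- 1) ^ card T :: real) = - 1"
      proof -
        have "card T > 0" using T fin by (auto simp: card_gt_0_iff)
        then obtain c where "card T = Suc c" by (cases "card T") auto
        thus ?thesis using sign_cyclic_perm[OF \<tau> fin(1)] by (simp flip: power_mult_distrib)
      qed
      ultimately show ?thesis by simp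
    qed
    thus ?thesis
      by (simp add: cycle_weight_def neg_minor_def sum_product sum_negf[symmetric] cong: sum.cong_simp)
  qed
  thus ?thesis
    unfolding neg_minor_def[of a S] sum_permutations_by_orbit[OF S v] by (simp add: sum_negf cong: sum.cong_simp)
qed

text \<open>In the Leibniz formula for \<open>x I - A\<close> let \<open>S\<close> be the indices at
  which \<open>- a\<close> is chosen. The others contribute \<open>x\<close> and must be fixed
  points, so the permutation lives on \<open>S\<close> and the terms collect to a principal
  minor.\<close>

lemma coeff_char_poly:
  fixes a :: "nat \<Rightarrow> nat \<Rightarrow> real"
  assumes m: "m \<le> n"
  shows "coeff (char_poly (mat n n (\<lambda>(i, j). a i j))) (n - m) =
    (\<Sum>S | S \<subseteq> {..<n} \<and> card S = m. neg_minor a S)"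
proof -
  let ?A = "mat n n (\<lambda>(i, j). a i j)" and ?V = "{0..<n}"
  have entry: "char_poly_matrix ?A $$ (i, j) = [:- a i j:] + (if j = i then monom 1 1 else 0)"
    if "i < n" "j < n" for i j
    using that by (auto simp: char_poly_matrix_def monom_altdef)
  have prod: "(\<Prod>i\<in>?V. char_poly_matrix ?A $$ (i, \<sigma> i)) =
     (\<Sum>S\<in>Pow ?V. if \<sigma> permutes S then monom (\<Prod>i\<in>S. - a i (\<sigma> i)) (n - card S) else 0)"
     if \<sigma>: "\<sigma> permutes ?V" for \<sigma>
  proof -
    have "(\<Prod>i\<in>?V. char_poly_matrix ?A $$ (i, \<sigma> i)) =
        (\<Prod>i\<in>?V. [:- a i (\<sigma> i):] + (if \<sigma> i = i then monom 1 1 else 0))"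
      using permutes_in_image[OF \<sigma>] by (intro prod.cong) (auto simp: entry)
    also have "\<dots> = (\<Sum>S\<in>Pow ?V. (\<Prod>i\<in>S. [:- a i (\<sigma> i):]) * (\<Prod>i\<in>?V - S. if \<sigma> i = i then monom 1 1 else 0))"
      by (rule prod_add) simp
    also have "\<dots> = (\<Sum>S\<in>Pow ?V. if \<sigma> permutes S then monom (\<Prod>i\<in>S. - a i (\<sigma> i)) (n - card S) else 0)"
    proof (rule sum.cong[OF refl])
      fix S assume "S \<in> Pow ?V"
      hence S: "S \<subseteq> ?V" "finite S" using finite_subset by auto
      have c: "(\<Prod>i\<in>S. [:- a i (\<sigma> i):]) = [:\<Prod>i\<in>S. - a i (\<sigma> i):]"
        using S(2) by (induction S rule: finite_induct) (auto simp: one_pCons)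
      show "(\<Prod>i\<in>S. [:- a i (\<sigma> i):]) * (\<Prod>i\<in>?V - S. if \<sigma> i = i then monom 1 1 else 0) =
        (if \<sigma> permutes S then monom (\<Prod>i\<in>S. - a i (\<sigma> i)) (n - card S) else 0)"
      proof (cases "\<forall>i\<in>?V - S. \<sigma> i = i")
        case True
        hence "\<sigma> permutes S" using permutes_superset[OF \<sigma>, of S] by auto
        moreover have "card (?V - S) = n - card S" using S by (simp add: card_Diff_subset)
        ultimately show ?thesis using True unfolding c by (simp add: monom_power smult_monom)
      next
        case False
        then obtain i where "i \<in> ?V - S" "\<sigma> i \<noteq> i" by blast
        hence "\<not> \<sigma> permutes S" using permutes_not_in[of \<sigma> S i] by auto
        moreover have "(\<Prod>i\<in>?V - S. if \<sigma> i = i then monom 1 1 else 0 :: real poly) = 0"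
          using False by (intro prod_zero) auto
        ultimately show ?thesis by simp
      qed
    qed
    finally show ?thesis .
  qed
  have "char_poly ?A = (\<Sum>\<sigma> | \<sigma> permutes ?V. of_int (sign \<sigma>) *
      (\<Sum>S\<in>Pow ?V. if \<sigma> permutes S then monom (\<Prod>i\<in>S. - a i (\<sigma> i)) (n - card S) else 0))"
    unfolding char_poly_def by (subst det_def'[of _ n]) (auto simp: prod intro!: sum.cong)
  also have "\<dots> = (\<Sum>\<sigma> | \<sigma> permutes ?V. (\<Sum>S\<in>Pow ?V. if \<sigma> permutes S then
      monom (of_int (sign \<sigma>) * (\<Prod>i\<in>S. - a i (\<sigma> i))) (n - card S) else 0))"
    unfolding sum_distrib_left by (intro sum.cong) (auto simp: of_int_monom mult_monom)
  also have "\<dots> = (\<Sum>S\<in>Pow ?V. \<Sum>\<sigma> | \<sigma> permutes ?V. if \<sigma> permutes S then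
      monom (of_int (sign \<sigma>) * (\<Prod>i\<in>S. - a i (\<sigma> i))) (n - card S) else 0)"
    by (rule sum.swap)
  also have "\<dots> = (\<Sum>S\<in>Pow ?V. monom (neg_minor a S) (n - card S))"
  proof (rule sum.cong[OF refl])
    fix S assume "S \<in> Pow ?V"
    hence S: "S \<subseteq> ?V" by simp
    have "(\<Sum>\<sigma> | \<sigma> permutes ?V. if \<sigma> permutes S then
        monom (of_int (sign \<sigma>) * (\<Prod>i\<in>S. - a i (\<sigma> i))) (n - card S) else 0) =
      (\<Sum>\<sigma> | \<sigma> permutes S. monom (of_int (sign \<sigma>) * (\<Prod>i\<in>S. - a i (\<sigma> i))) (n - card S))"
      using permutes_subset[OF _ S] by (intro sum.mono_neutral_cong_right) (auto intro: finite_permutations)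
    thus "(\<Sum>\<sigma> | \<sigma> permutes ?V. if \<sigma> permutes S then
        monom (of_int (sign \<sigma>) * (\<Prod>i\<in>S. - a i (\<sigma> i))) (n - card S) else 0) = monom (neg_minor a S) (n - card S)"
      by (simp add: neg_minor_def monom_sum)
  qed
  finally have "coeff (char_poly ?A) (n - m) = (\<Sum>S\<in>Pow ?V. coeff (monom (neg_minor a S) (n - card S)) (n - m))"
    by (simp add: coeff_sum)
  also have "\<dots> = (\<Sum>S | S \<subseteq> {..<n} \<and> card S = m. neg_minor a S)"
  proof (rule sum.mono_neutral_cong_right)
    show "\<forall>S\<in>Pow ?V - {S. S \<subseteq> {..<n} \<and> card S = m}. coeff (monom (neg_minor a S) (n - card S)) (n - m) = 0"
    proof
      fix S assume S: "S \<in> Pow ?V - {S. S \<subseteq> {..<n} \<and> card S = m}"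
      hence "card S \<le> n" using card_mono[of ?V S] by auto
      thus "coeff (monom (neg_minor a S) (n - card S)) (n - m) = 0" using S m by auto
    qed
  qed (auto simp: atLeast0LessThan)
  finally show ?thesis .
qed

section \<open>Cycles across a cut of a strongly connected digraph\<close>

text \<open>The \<open>m\<close>-th power of the cycle rotates the list by \<open>m\<close> places,
  so the orbit of the head reaches every entry.\<close>

lemma cyclic_on_cycle_of_list:
  assumes "distinct cs" "cs \<noteq> []"
  shows "cyclic_on (cycle_of_list cs) (set cs)"
proof -
  let ?c = "cycle_of_list cs"
  have "x \<in> orbit ?c (hd cs)" if x: "x \<in> set cs" for x
  proof -
    obtain m where m: "m < length cs" "x = cs ! m" using x unfolding in_set_conv_nth by blast
    have "(?c ^^ m) (hd cs) = map (?c ^^ m) cs ! 0"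
      unfolding hd_conv_nth[OF assms(2)] by (rule nth_map[symmetric]) (use m(1) in linarith)
    also have "\<dots> = rotate m cs ! 0" by (simp only: cyclic_rotation[OF assms(1)])
    also have "\<dots> = x"
    proof -
      have "0 < length cs" using m(1) by linarith
      from nth_rotate[OF this, of m] show ?thesis using m by simp
    qed
    finally have "(?c ^^ m) (hd cs) = x" .
    thus ?thesis unfolding orbit_altdef_permutation[OF permutation_of_cycle] by auto
  qed
  moreover have "orbit ?c (hd cs) \<subseteq> set cs"
    using cycle_permutes assms by (intro permutes_orbit_subset) auto
  ultimately show ?thesis using assms by (intro cyclic_on_singleI[of "hd cs"]) auto
qed

text \<open>Take an edge leaving \<open>U\<close> and close it by a simple path back to its source,
  which strong connectivity provides.\<close>

lemma crossing_cycle: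
  fixes a :: "nat \<Rightarrow> nat \<Rightarrow> real"
  assumes irr: "irreducible_mat (mat n n (\<lambda>(i, j). a i j))" and nonneg: "\<And>i j. 0 \<le> a i j"
    and U: "U \<subseteq> {..<n}" "U \<noteq> {}" "U \<noteq> {..<n}"
  obtains T where "T \<subseteq> {..<n}" "0 < cycle_weight a T" "T \<inter> U \<noteq> {}" "\<not> T \<subseteq> U"
proof -
  define E where "E i j \<longleftrightarrow> i < n \<and> j < n \<and> a i j \<noteq> 0" for i j
  have exits: "\<exists>i\<in>W. \<exists>j\<in>{..<n} - W. E i j" if W: "W \<subseteq> {..<n}" "W \<noteq> {}" "W \<noteq> {..<n}" for W
  proof -
    have "mat n n (\<lambda>(i, j). a i j) \<in> carrier_mat n n" by simp
    from irr[unfolded irreducible_mat_iff[OF this], rule_format, OF W] obtain i j where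
      "i \<in> W" "j \<in> {..<n} - W" "mat n n (\<lambda>(i, j). a i j) $$ (i, j) \<noteq> 0" by blast
    moreover from this have "i < n" "j < n" using W by auto
    ultimately show ?thesis unfolding E_def by auto
  qed
  have reach: "E\<^sup>*\<^sup>* x y" if "x < n" "y < n" for x y
  proof -
    let ?R = "{y. y < n \<and> E\<^sup>*\<^sup>* x y}"
    have "?R = {..<n}"
    proof (rule ccontr)
      assume "?R \<noteq> {..<n}"
      moreover have "?R \<noteq> {}" using that(1) by blast
      ultimately obtain i j where "i \<in> ?R" "j \<in> {..<n} - ?R" "E i j" using exits[of ?R] by blast
      thus False by (auto dest: rtranclp.rtrancl_into_rtrancl)
    qed
    thus ?thesis using that by blast
  qed
  obtain i j where ij: "i \<in> U" "j \<in> {..<n} - U" "E i j" using exits[OF U] by blast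
  have "E\<^sup>*\<^sup>* j i" using ij U by (intro reach) auto
  then obtain ys where "rtrancl_path E j ys i" unfolding rtranclp_eq_rtrancl_path by blast
  then obtain xs where xs: "rtrancl_path E j xs i" "distinct (j # xs)" by (rule rtrancl_path_distinct)
  \<comment> \<open>The path leads from \<open>j\<close> to \<open>i\<close>, so the wrap-around
    step of this cyclic list is the edge from \<open>i\<close> to \<open>j\<close> that leaves
    \<open>U\<close>.\<close>
  define cs where "cs = j # xs"
  define c where "c = cycle_of_list cs"
  have "xs \<noteq> []" using xs(1) ij by (auto elim: rtrancl_path.cases)
  have last: "last cs = i" using rtrancl_path_last[OF xs(1) \<open>xs \<noteq> []\<close>] \<open>xs \<noteq> []\<close> by (simp add: cs_def)
  have dist: "distinct cs" using xs(2) by (simp add: cs_def)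
  have edge: "E x (c x)" if x: "x \<in> set cs" for x
  proof -
    obtain m where m: "m < length cs" "x = cs ! m" using x unfolding in_set_conv_nth by blast
    have "c x = map (c ^^ 1) cs ! m" unfolding nth_map[OF m(1)] m(2) by simp
    also have "\<dots> = rotate 1 cs ! m" unfolding c_def by (simp only: cyclic_rotation[OF dist])
    also have "\<dots> = cs ! (Suc m mod length cs)" using m by (simp add: nth_rotate1)
    finally have cx: "c x = cs ! (Suc m mod length cs)" .
    show ?thesis
    proof (cases "Suc m = length cs")
      case True
      hence "m = length cs - 1" "cs \<noteq> []" using m by auto
      hence "x = i" using last_conv_nth[of cs] last m(2) by simp
      moreover have "c x = cs ! 0" using cx True by simp
      moreover have "cs ! 0 = j" by (simp add: cs_def)
      ultimately show ?thesis using ij(3) by simp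
    next
      case False
      hence "Suc m < length cs" using m by simp
      hence "c x = cs ! Suc m" using cx by simp
      hence "c x = xs ! m" by (simp add: cs_def)
      moreover have "m < length xs" using m False by (simp add: cs_def)
      ultimately show ?thesis using rtrancl_path_nth[OF xs(1), of m] m by (simp add: cs_def)
    qed
  qed
  have "cs \<noteq> []" by (simp add: cs_def)
  have "c \<in> cyclic_perms (set cs)"
    unfolding cyclic_perms_def c_def using cycle_permutes[of cs] cyclic_on_cycle_of_list[OF dist \<open>cs \<noteq> []\<close>] by simp
  moreover have "finite (cyclic_perms (set cs))"
  proof (rule finite_subset[OF _ finite_permutations[of "set cs"]])
    show "cyclic_perms (set cs) \<subseteq> {c. c permutes set cs}" by (auto simp: cyclic_perms_def)
  qed simp
  moreover have pos: "0 < (\<Prod>x\<in>set cs. a x (c x))"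
  proof (rule prod_pos)
    fix x assume "x \<in> set cs"
    hence "a x (c x) \<noteq> 0" using edge unfolding E_def by blast
    thus "0 < a x (c x)" using nonneg[of x "c x"] by simp
  qed
  ultimately have "0 < cycle_weight a (set cs)"
    unfolding cycle_weight_def using nonneg
      sum_pos2[of "cyclic_perms (set cs)" c "\<lambda>\<tau>. \<Prod>x\<in>set cs. a x (\<tau> x)"] by (simp add: prod_nonneg)
  moreover have "set cs \<subseteq> {..<n}" using edge unfolding E_def by auto
  moreover have "i \<in> set cs" using last last_in_set[OF \<open>cs \<noteq> []\<close>] by simp
  moreover have "j \<in> set cs" by (simp add: cs_def)
  ultimately show ?thesis using that[of "set cs"] ij by blast
qed

lemma cycle_weight_nonneg: "(\<And>i j. 0 \<le> a i j) \<Longrightarrow> 0 \<le> cycle_weight a T"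
  unfolding cycle_weight_def by (intro sum_nonneg prod_nonneg) auto

section \<open>Necessary conditions\<close>

text \<open>The entries form a total function, nonnegative everywhere, because
  \<open>cycle_weights\<close> asks for nonnegative weights on arbitrary sets;
  \<open>gap_matrixI\<close> pads the matrix with zeros.\<close>

locale gap_matrix =
  fixes p :: nat and a :: "nat \<Rightarrow> nat \<Rightarrow> real" and k :: "nat \<Rightarrow> real"
  assumes p3: "p \<ge> 3" and a_nonneg: "0 \<le> a i j"
    and char_poly: "char_poly (mat (2 * p + 1) (2 * p + 1) (\<lambda>(i, j). a i j)) = gap_poly p k"
begin

lemma p2: "p \<ge> 2" using p3 by simp

sublocale cycle_weights p "cycle_weight a"
  using p2 a_nonneg cycle_weight_nonneg by unfold_locales auto

abbreviation "w \<equiv> cycle_weight a"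
abbreviation "f \<equiv> neg_minor a"

lemma sum_neg_minor:
  assumes "m \<le> 2 * p + 1"
  shows "(\<Sum>S | S \<subseteq> V \<and> card S = m. f S) = (if m = 0 then 1 else if p \<le> m then k m else 0)"
  using coeff_char_poly[of m "2 * p + 1" a] assms coeff_gap_poly[of p m k] p unfolding char_poly by simp

lemma finite_sub: "S \<subseteq> V \<Longrightarrow> finite S"
  using finite_subset by blast

lemma finite_sets: "finite {S. S \<subseteq> V \<and> Q S}"
  by (rule finite_subset[of _ "Pow V"]) auto

lemma neg_minor_of_short_free:
  assumes S: "S \<subseteq> V" "S \<noteq> {}" and short: "\<And>T. T \<subset> S \<Longrightarrow> T \<noteq> {} \<Longrightarrow> w T = 0 \<or> f (S - T) = 0"
  shows "f S = - w S"
proof -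
  obtain v where v: "v \<in> S" using S by auto
  have "(\<Sum>T | v \<in> T \<and> T \<subseteq> S. w T * f (S - T)) = (\<Sum>T\<in>{S}. w T * f (S - T))"
  proof (rule sum.mono_neutral_right)
    show "\<forall>T\<in>{T. v \<in> T \<and> T \<subseteq> S} - {S}. w T * f (S - T) = 0"
    proof
      fix T assume T: "T \<in> {T. v \<in> T \<and> T \<subseteq> S} - {S}"
      hence "T \<subset> S" "T \<noteq> {}" by auto
      from short[OF this] show "w T * f (S - T) = 0" by auto
    qed
  qed (use v finite_sub[OF S(1)] in auto)
  thus ?thesis using neg_minor_expand[OF finite_sub[OF S(1)] v, of a] by simp
qed

text \<open>Once there are no cycles shorter than \<open>m < p\<close>, the vanishing coefficient of degree
  \<open>2 * p + 1 - m\<close> is minus the total weight of the \<open>m\<close>-cycles.\<close>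

lemma no_short_cycle: "T \<subseteq> V \<Longrightarrow> 0 < card T \<Longrightarrow> card T < p \<Longrightarrow> w T = 0"
proof (induction "card T" arbitrary: T rule: less_induct)
  case less
  define m where "m = card T"
  have eq: "f S = - w S" if S: "S \<subseteq> V" "card S = m" for S
  proof (rule neg_minor_of_short_free[OF S(1)])
    show "S \<noteq> {}" using S less.prems m_def by auto
    fix T' assume T': "T' \<subset> S" "T' \<noteq> {}"
    have "finite S" by (rule finite_sub[OF S(1)])
    hence "card T' < card S" "0 < card T'"
      using T' psubset_card_mono finite_subset[of T' S] by (auto simp: card_gt_0_iff)
    hence "w T' = 0" using less.hyps[of T'] less.prems T' S m_def by auto
    thus "w T' = 0 \<or> f (S - T') = 0" ..
  qed
  have "(\<Sum>S | S \<subseteq> V \<and> card S = m. f S) = 0"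
    using sum_neg_minor[of m] less.prems m_def by auto
  hence "(\<Sum>S | S \<subseteq> V \<and> card S = m. w S) = 0" using eq by (simp add: sum_negf)
  thus "w T = 0"
    by (rule sum_nonneg_0[OF finite_sets _ _, rotated]) (use less.prems w_nonneg m_def in auto)
qed

lemma neg_minor_short:
  assumes S: "S \<subseteq> V" "0 < card S" "card S < p"
  shows "f S = 0"
proof -
  have "f S = - w S"
  proof (rule neg_minor_of_short_free[OF S(1)])
    show "S \<noteq> {}" using S by auto
    fix T assume T: "T \<subset> S" "T \<noteq> {}"
    have "finite S" by (rule finite_sub[OF S(1)])
    hence "card T < card S" "0 < card T"
      using T psubset_card_mono finite_subset[of T S] by (auto simp: card_gt_0_iff)
    hence "w T = 0" using no_short_cycle[of T] S T by auto
    thus "w T = 0 \<or> f (S - T) = 0" ..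
  qed
  thus ?thesis using no_short_cycle[of S] S by simp
qed

text \<open>Fewer than \<open>2 * p\<close> vertices cannot be split into two parts of size at least
  \<open>p\<close>, so each proper term of the expansion has a factor that vanishes.\<close>

lemma neg_minor_mid:
  assumes S: "S \<subseteq> V" "p \<le> card S" "card S < 2 * p"
  shows "f S = - w S"
proof (rule neg_minor_of_short_free[OF S(1)])
  show "S \<noteq> {}" using S p by auto
  fix T assume T: "T \<subset> S" "T \<noteq> {}"
  have fin: "finite S" "finite T" using finite_sub[OF S(1)] T finite_subset by auto
  have c: "card (S - T) = card S - card T" "card T < card S" "0 < card T"
    using T fin psubset_card_mono by (auto simp: card_Diff_subset card_gt_0_iff)
  show "w T = 0 \<or> f (S - T) = 0"
  proof (cases "card T < p")
    case True
    thus ?thesis using no_short_cycle[of T] T S c by auto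
  next
    case False
    hence "card (S - T) < p" "0 < card (S - T)" using c S by auto
    thus ?thesis using neg_minor_short[of "S - T"] S by auto
  qed
qed

lemma coeff_mid:
  assumes "p \<le> m" "m < 2 * p"
  shows "k m = - (\<Sum>S | S \<subseteq> V \<and> card S = m. w S)"
  using sum_neg_minor[of m] assms p neg_minor_mid by (simp add: sum_negf)

lemma coeff_p: "k p = - \<alpha>"
  using coeff_mid[of p] p by (simp add: \<alpha>_def \<P>_def)

lemma coeff_Suc_p: "k (p + 1) = - \<beta>"
  using coeff_mid[of "p + 1"] p by (simp add: \<beta>_def \<C>_def)

text \<open>A surviving term with \<open>T \<noteq> S\<close> has both parts of size at least
  \<open>p\<close>; then \<open>S - T\<close> has at most \<open>p + 1 < 2 * p\<close> vertices, and
  \<open>neg_minor_mid\<close> reduces it to a single cycle.\<close>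

lemma neg_minor_long:
  assumes S: "S \<subseteq> V" "2 * p \<le> card S" and v: "v \<in> S"
  shows "f S = - w S + (\<Sum>T | v \<in> T \<and> T \<subseteq> S \<and> p \<le> card T \<and> p \<le> card (S - T). w T * w (S - T))"
proof -
  have fin: "finite S" by (rule finite_sub[OF S(1)])
  let ?X = "{T. v \<in> T \<and> T \<subseteq> S}" and ?Y = "{T. v \<in> T \<and> T \<subseteq> S \<and> p \<le> card T \<and> p \<le> card (S - T)}"
  have "(\<Sum>T\<in>?X. w T * f (S - T)) = (\<Sum>T\<in>insert S ?Y. w T * f (S - T))"
  proof (rule sum.mono_neutral_right)
    show "\<forall>T\<in>?X - insert S ?Y. w T * f (S - T) = 0"
    proof
      fix T assume T: "T \<in> ?X - insert S ?Y"
      have fT: "finite T" using T fin finite_subset by auto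
      have "0 < card T" "0 < card (S - T)" using T fT fin by (auto simp: card_gt_0_iff)
      moreover have "T \<subseteq> V" "S - T \<subseteq> V" using T S by auto
      moreover have "card T < p \<or> card (S - T) < p" using T by auto
      ultimately have "w T = 0 \<or> f (S - T) = 0"
        using no_short_cycle[of T] neg_minor_short[of "S - T"] by blast
      thus "w T * f (S - T) = 0" by auto
    qed
  qed (use v fin in auto)
  also have "\<dots> = w S * f (S - S) + (\<Sum>T\<in>?Y. w T * f (S - T))"
    using fin p by (subst sum.insert) auto
  also have "(\<Sum>T\<in>?Y. w T * f (S - T)) = (\<Sum>T\<in>?Y. w T * - w (S - T))"
  proof (rule sum.cong[OF refl])
    fix T assume T: "T \<in> ?Y"
    have "card S \<le> 2 * p + 1" using card_mono[OF _ S(1)] by simp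
    moreover have "card (S - T) = card S - card T"
      using T by (intro card_Diff_subset finite_subset[OF _ fin]) auto
    moreover have "p \<le> card T" "p \<le> card (S - T)" "S - T \<subseteq> V" using T S by auto
    ultimately have "f (S - T) = - w (S - T)" using p by (intro neg_minor_mid) linarith+
    thus "w T * f (S - T) = w T * - w (S - T)" by simp
  qed
  finally show ?thesis
    using neg_minor_expand[OF fin v, of a] by (simp add: sum_negf)
qed

text \<open>Expansion at \<open>v\<close> names each pair of complementary \<open>p\<close>-sets by
  the member containing \<open>v\<close>; the sum over all \<open>T\<close> meets every pair
  twice.\<close>

lemma pairs_within:
  assumes S: "S \<subseteq> V" "card S = 2 * p"
  shows "f S = - w S + (\<Sum>T | T \<subseteq> S \<and> card T = p. w T * w (S - T)) / 2"
proof -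
  have fin: "finite S" by (rule finite_sub[OF S(1)])
  obtain v where v: "v \<in> S" using S p by (metis card.empty equals0I le_zero_eq mult_eq_0_iff not_numeral_le_zero zero_neq_numeral)
  have cD: "card (S - T) = 2 * p - card T" if "T \<subseteq> S" for T
    using that S fin finite_subset by (metis card_Diff_subset)
  let ?X = "{T. v \<in> T \<and> T \<subseteq> S \<and> card T = p}" and ?Y = "{T. v \<notin> T \<and> T \<subseteq> S \<and> card T = p}"
  have "{T. v \<in> T \<and> T \<subseteq> S \<and> p \<le> card T \<and> p \<le> card (S - T)} = ?X"
    using cD p by fastforce
  hence "f S = - w S + (\<Sum>T\<in>?X. w T * w (S - T))"
    using neg_minor_long[OF S(1) _ v] S by simp
  moreover have "(\<Sum>T | T \<subseteq> S \<and> card T = p. w T * w (S - T)) =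
      (\<Sum>T\<in>?X. w T * w (S - T)) + (\<Sum>T\<in>?Y. w T * w (S - T))"
  proof -
    have "{T. T \<subseteq> S \<and> card T = p} = ?X \<union> ?Y" by blast
    moreover have "finite ?X" "finite ?Y" "?X \<inter> ?Y = {}" using fin by auto
    ultimately show ?thesis by (simp only: sum.union_disjoint)
  qed
  moreover have "(\<Sum>T\<in>?Y. w T * w (S - T)) = (\<Sum>T\<in>?X. w T * w (S - T))"
    by (rule sum.reindex_bij_witness[of _ "\<lambda>T. S - T" "\<lambda>T. S - T"])
      (use v cD in \<open>auto simp: double_diff mult.commute\<close>)
  ultimately show ?thesis by simp
qed

lemma coeff_2p: "k (2 * p) = disjoint_pairs - (\<Sum>S | S \<subseteq> V \<and> card S = 2 * p. w S)"
proof -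
  let ?D = "{S. S \<subseteq> V \<and> card S = 2 * p}"
  have "k (2 * p) = (\<Sum>S\<in>?D. f S)" using sum_neg_minor[of "2 * p"] p by simp
  also have "\<dots> = (\<Sum>S\<in>?D. - w S + (\<Sum>T | T \<subseteq> S \<and> card T = p. w T * w (S - T)) / 2)"
    using pairs_within by (intro sum.cong) auto
  also have "\<dots> = - (\<Sum>S\<in>?D. w S) + (\<Sum>S\<in>?D. \<Sum>T | T \<subseteq> S \<and> card T = p. w T * w (S - T)) / 2"
    by (simp only: sum.distrib sum_negf flip: sum_divide_distrib)
  also have "(\<Sum>S\<in>?D. \<Sum>T | T \<subseteq> S \<and> card T = p. w T * w (S - T)) =
     (\<Sum>(S, T)\<in>(SIGMA S:?D. {T. T \<subseteq> S \<and> card T = p}). w T * w (S - T))"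
    using finite_sets finite_sub by (intro sum.Sigma) auto
  \<comment> \<open>Each ordered pair of disjoint \<open>p\<close>-sets arises exactly once, with
    \<open>S\<close> as its union.\<close>
  also have "\<dots> = (\<Sum>(T, T')\<in>{(T, T'). T \<in> \<P> \<and> T' \<in> \<P> \<and> T \<inter> T' = {}}. w T * w T')"
  proof (rule sum.reindex_bij_witness[where i = "\<lambda>(T, T'). (T \<union> T', T)" and j = "\<lambda>(S, T). (T, S - T)"])
    fix x assume "x \<in> (SIGMA S:?D. {T. T \<subseteq> S \<and> card T = p})"
    then obtain S T where x: "x = (S, T)" and S: "S \<subseteq> V" "card S = 2 * p" and T: "T \<subseteq> S" "card T = p" by auto
    have "card (S - T) = p" using S T finite_sub finite_subset by (subst card_Diff_subset) auto
    thus "(\<lambda>(S, T). (T, S - T)) x \<in> {(T, T'). T \<in> \<P> \<and> T' \<in> \<P> \<and> T \<inter> T' = {}}"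
      using S T by (auto simp: x \<P>_def)
    show "(\<lambda>(T, T'). (T \<union> T', T)) ((\<lambda>(S, T). (T, S - T)) x) = x" using T by (auto simp: x)
    show "(case (\<lambda>(S, T). (T, S - T)) x of (T, T') \<Rightarrow> w T * w T') = (case x of (S, T) \<Rightarrow> w T * w (S - T))"
      by (simp add: x)
  next
    fix y assume "y \<in> {(T, T'). T \<in> \<P> \<and> T' \<in> \<P> \<and> T \<inter> T' = {}}"
    then obtain T T' where y: "y = (T, T')" and T: "T \<subseteq> V" "card T = p" "T' \<subseteq> V" "card T' = p" "T \<inter> T' = {}"
      by (auto simp: \<P>_def)
    have "card (T \<union> T') = 2 * p" using T finite_sub by (subst card_Un_disjoint) auto
    thus "(\<lambda>(T, T'). (T \<union> T', T)) y \<in> (SIGMA S:?D. {T. T \<subseteq> S \<and> card T = p})" using T by (auto simp: y)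
    show "(\<lambda>(S, T). (T, S - T)) ((\<lambda>(T, T'). (T \<union> T', T)) y) = y" using T by (auto simp: y)
  qed
  also have "\<dots> = (\<Sum>(T, T')\<in>\<P> \<times> \<P>. if T \<inter> T' = {} then w T * w T' else 0)"
    using finite_P by (intro sum.mono_neutral_cong_left) (auto split: if_splits)
  also have "\<dots> = 2 * disjoint_pairs" by (simp add: disjoint_pairs_def sum.cartesian_product)
  finally show ?thesis by simp
qed

lemma coeff_2p1: "k (2 * p + 1) = complementary_pairs - w V"
proof -
  have "0 \<in> V" by simp
  let ?X = "{T. 0 \<in> T \<and> T \<subseteq> V \<and> p \<le> card T \<and> p \<le> card (V - T)}"
  have cD: "card (V - T) = 2 * p + 1 - card T" if "T \<subseteq> V" for T
    using that finite_sub by (subst card_Diff_subset) auto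
  have cle: "card T \<le> 2 * p + 1" if "T \<subseteq> V" for T using card_mono[OF _ that] by simp
  have "{S. S \<subseteq> V \<and> card S = 2 * p + 1} = {V}"
    using card_subset_eq[of V] by auto
  hence "k (2 * p + 1) = f V" using sum_neg_minor[of "2 * p + 1"] p by simp
  also have "\<dots> = - w V + (\<Sum>T\<in>?X. w T * w (V - T))"
    by (rule neg_minor_long) auto
  also have "(\<Sum>T\<in>?X. w T * w (V - T)) = complementary_pairs"
  proof -
    \<comment> \<open>Expansion at vertex 0 names each complementary pair by its member containing
      0; passing to complements where that member has size \<open>p\<close> gives all
      \<open>(p + 1)\<close>-sets.\<close>
    have X: "?X = {T \<in> \<C>. 0 \<in> T} \<union> {T \<in> \<P>. 0 \<in> T}"
    proof (intro Set.set_eqI iffI)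
      fix T assume "T \<in> ?X"
      moreover from this have "card T = p \<or> card T = p + 1" using cD[of T] cle[of T] by auto
      ultimately show "T \<in> {T \<in> \<C>. 0 \<in> T} \<union> {T \<in> \<P>. 0 \<in> T}" by (auto simp: \<C>_def \<P>_def)
    next
      fix T assume "T \<in> {T \<in> \<C>. 0 \<in> T} \<union> {T \<in> \<P>. 0 \<in> T}"
      thus "T \<in> ?X" using cD[of T] by (auto simp: \<C>_def \<P>_def)
    qed
    have "(\<Sum>T\<in>?X. w T * w (V - T)) = (\<Sum>T | T \<in> \<C> \<and> 0 \<in> T. w T * w (V - T)) + (\<Sum>T | T \<in> \<P> \<and> 0 \<in> T. w T * w (V - T))"
      unfolding X using finite_C finite_P by (intro sum.union_disjoint) (auto simp: \<C>_def \<P>_def)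
    also have "(\<Sum>T | T \<in> \<P> \<and> 0 \<in> T. w T * w (V - T)) = (\<Sum>T | T \<in> \<C> \<and> 0 \<notin> T. w T * w (V - T))"
      by (rule sum.reindex_bij_witness[of _ "\<lambda>T. V - T" "\<lambda>T. V - T"])
        (use cD p in \<open>auto simp: double_diff mult.commute \<C>_def \<P>_def\<close>)
    also have "(\<Sum>T | T \<in> \<C> \<and> 0 \<in> T. w T * w (V - T)) + \<dots> =
        (\<Sum>T\<in>{T \<in> \<C>. 0 \<in> T} \<union> {T \<in> \<C>. 0 \<notin> T}. w T * w (V - T))"
      using finite_C by (intro sum.union_disjoint[symmetric]) auto
    also have "{T \<in> \<C>. 0 \<in> T} \<union> {T \<in> \<C>. 0 \<notin> T} = \<C>" by auto
    finally show ?thesis by (simp add: complementary_pairs_def)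
  qed
  finally show ?thesis by simp
qed

lemma coeff_nonpos: "p \<le> m \<Longrightarrow> m < 2 * p \<Longrightarrow> k m \<le> 0"
  using coeff_mid[of m] w_nonneg by (simp add: sum_nonneg)

lemma \<beta>_nonneg: "0 \<le> \<beta>"
  using w_nonneg by (auto simp: \<beta>_def intro: sum_nonneg)

lemma coeff_2p_le: "k (2 * p) \<le> max_weight * (\<alpha> - max_weight)"
proof -
  have "0 \<le> (\<Sum>S | S \<subseteq> V \<and> card S = 2 * p. w S)" using w_nonneg by (intro sum_nonneg) auto
  thus ?thesis using coeff_2p disjoint_pairs_le by linarith
qed

lemma coeff_2p1_le: "k (2 * p + 1) \<le> \<beta> * max_weight"
  using coeff_2p1 complementary_pairs_le w_nonneg[of V] by linarith

lemma coeff_2p_le_square: "k (2 * p) \<le> (k p)\<^sup>2 / 4"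
proof -
  have "0 \<le> (\<alpha> - 2 * max_weight)\<^sup>2" by simp
  thus ?thesis using coeff_2p_le by (simp add: coeff_p power2_eq_square algebra_simps)
qed

lemma max_weight_le_extremal_weight: "max_weight \<le> extremal_weight p k"
proof (cases "k (2 * p) \<le> 0")
  case True
  thus ?thesis using max_weight_le by (simp add: extremal_weight_def coeff_p)
next
  case False
  have "(max_weight - \<alpha> / 2)\<^sup>2 \<le> \<alpha>\<^sup>2 / 4 - k (2 * p)"
    using coeff_2p_le by (simp add: power2_eq_square algebra_simps)
  hence "max_weight - \<alpha> / 2 \<le> sqrt (\<alpha>\<^sup>2 / 4 - k (2 * p))" by (rule real_le_rsqrt)
  thus ?thesis using False by (simp add: extremal_weight_def coeff_p)
qed

lemma coeff_2p1_le_extremal: "k (2 * p + 1) \<le> - k (p + 1) * extremal_weight p k"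
  using coeff_2p1_le mult_left_mono[OF max_weight_le_extremal_weight \<beta>_nonneg]
  unfolding coeff_Suc_p by simp

text \<open>Tightness removes the cycles of lengths \<open>2 * p\<close> and
  \<open>2 * p + 1\<close>, and \<open>zero\<close> those between \<open>p + 1\<close> and
  \<open>2 * p\<close>. The remaining ones respect the cut of \<open>extremal_split\<close>, whereas
  irreducibility would supply a cycle across it.\<close>

lemma not_irreducible:
  assumes tight: "k (2 * p) = max_weight * (\<alpha> - max_weight)" "k (2 * p + 1) = \<beta> * max_weight"
    and s: "0 < max_weight" "\<alpha> \<le> 2 * max_weight"
    and s': "(\<alpha> < 2 * max_weight \<and> 0 < \<beta>) \<or> (max_weight < \<alpha> \<and> \<beta> = 0)"
    and zero: "\<And>m. p + 2 \<le> m \<Longrightarrow> m < 2 * p \<Longrightarrow> k m = 0"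
  shows "\<not> irreducible_mat (mat (2 * p + 1) (2 * p + 1) (\<lambda>(i, j). a i j))"
proof
  assume irr: "irreducible_mat (mat (2 * p + 1) (2 * p + 1) (\<lambda>(i, j). a i j))"
  have "0 \<le> (\<Sum>S | S \<subseteq> V \<and> card S = 2 * p. w S)" using w_nonneg by (intro sum_nonneg) auto
  hence D: "disjoint_pairs = max_weight * (\<alpha> - max_weight)" and z2p: "(\<Sum>S | S \<subseteq> V \<and> card S = 2 * p. w S) = 0"
    using coeff_2p disjoint_pairs_le tight by linarith+
  have C: "complementary_pairs = \<beta> * max_weight" and zV: "w V = 0"
    using coeff_2p1 complementary_pairs_le tight w_nonneg[of V] by linarith+
  have z: "w T = 0" if T: "T \<subseteq> V" "T \<notin> \<P> \<union> \<C>" "T \<noteq> {}" for T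
  proof -
    have "card T \<le> 2 * p + 1" using card_mono[OF _ T(1)] by simp
    moreover have "card T \<noteq> p" "card T \<noteq> p + 1" using T by (auto simp: \<P>_def \<C>_def)
    moreover have "0 < card T" using T finite_sub by (simp add: card_gt_0_iff)
    ultimately consider "0 < card T" "card T < p" | "p + 2 \<le> card T" "card T < 2 * p"
      | "card T = 2 * p" | "card T = 2 * p + 1" by linarith
    thus ?thesis
    proof cases
      case 1
      thus ?thesis using no_short_cycle T by simp
    next
      case 2
      hence "(\<Sum>S | S \<subseteq> V \<and> card S = card T. w S) = 0" using coeff_mid[of "card T"] zero by simp
      thus ?thesis by (rule sum_nonneg_0[OF finite_sets _ _, rotated]) (use T w_nonneg in auto)
    next
      case 3
      show ?thesis
        by (rule sum_nonneg_0[OF finite_sets _ z2p]) (use T 3 w_nonneg in auto)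
    next
      case 4
      hence "T = V" using T by (intro card_subset_eq) auto
      thus ?thesis using zV by simp
    qed
  qed
  obtain U where U: "U \<subseteq> V" "U \<noteq> {}" "U \<noteq> V"
    and split: "\<forall>T\<in>\<P> \<union> \<C>. 0 < w T \<longrightarrow> T \<subseteq> U \<or> T \<inter> U = {}"
    using extremal_split[OF D C s s'] by blast
  obtain T where T: "T \<subseteq> V" "0 < w T" "T \<inter> U \<noteq> {}" "\<not> T \<subseteq> U"
    by (rule crossing_cycle[OF irr a_nonneg U])
  have "T \<noteq> {}" using T by auto
  hence "T \<in> \<P> \<union> \<C>" using z[of T] T by auto
  thus False using split T by blast
qed

text \<open>The two bounds leave a single value for \<open>max_weight\<close>: \<alpha> in case 1,
  \<open>\<alpha> / 2 + r\<close> in case 2, \<open>\<alpha> / 2\<close> in case 3. At this value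
  both are equalities.\<close>

lemma not_irreducible_in_cases:
  assumes "case1 p k \<or> case2 p k \<or> case3 p k"
  shows "\<not> irreducible_mat (mat (2 * p + 1) (2 * p + 1) (\<lambda>(i, j). a i j))"
  using assms
proof (elim disjE)
  assume c: "case1 p k"
  hence pos: "0 < \<alpha>" "0 < \<beta>" and k: "k (2 * p) = 0" "k (2 * p + 1) = \<alpha> * \<beta>"
    using p unfolding case1_def coeff_p coeff_Suc_p by auto
  have "\<beta> * \<alpha> \<le> \<beta> * max_weight" using coeff_2p1_le k by (simp add: mult.commute)
  hence s: "max_weight = \<alpha>" using pos max_weight_le by simp
  show ?thesis
    by (rule not_irreducible) (use pos k s c in \<open>auto simp: case1_def mult.commute\<close>)
next
  assume c: "case2 p k"
  define r where "r = sqrt (\<alpha>\<^sup>2 / 4 - k (2 * p))"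
  have pos: "0 < \<alpha>" "0 < \<beta>" and k12: "0 < k (2 * p)" "k (2 * p) < \<alpha>\<^sup>2 / 4"
    using c unfolding case2_def coeff_p coeff_Suc_p by simp_all
  have "k p / 2 - sqrt ((k p)\<^sup>2 / 4 - k (2 * p)) = - (\<alpha> / 2 + r)" by (simp add: coeff_p r_def)
  hence "k (2 * p + 1) = - \<beta> * (- (\<alpha> / 2 + r))"
    using c unfolding case2_def coeff_Suc_p by metis
  hence "k (2 * p + 1) = \<beta> * (\<alpha> / 2 + r)" by (simp only: minus_mult_minus)
  note k = k12 this
  have r: "0 < r" "r\<^sup>2 = \<alpha>\<^sup>2 / 4 - k (2 * p)" using k by (simp_all add: r_def)
  have "\<beta> * (\<alpha> / 2 + r) \<le> \<beta> * max_weight" using coeff_2p1_le k by simp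
  hence "\<alpha> / 2 + r \<le> max_weight" using pos by simp
  moreover have "max_weight \<le> \<alpha> / 2 + r"
    using max_weight_le_extremal_weight k(1) by (simp add: extremal_weight_def coeff_p r_def)
  ultimately have s: "max_weight = \<alpha> / 2 + r" by simp
  have "max_weight * (\<alpha> - max_weight) = \<alpha>\<^sup>2 / 4 - r\<^sup>2"
    unfolding s by (simp add: power2_eq_square algebra_simps)
  hence "k (2 * p) = max_weight * (\<alpha> - max_weight)" using r by simp
  thus ?thesis
    by (rule not_irreducible) (use pos k s r c in \<open>auto simp: case2_def\<close>)
next
  assume c: "case3 p k"
  have pos: "0 < \<alpha>" and k: "k (2 * p) = \<alpha>\<^sup>2 / 4" "k (2 * p + 1) = 0"
    using c by (simp_all add: case3_def coeff_p)
  have "k (p + 1) = 0" if "p + 1 \<le> 2 * p - 1" using c that by (simp add: case3_def)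
  hence \<beta>: "\<beta> = 0" using coeff_Suc_p p3 by simp
  have "(max_weight - \<alpha> / 2)\<^sup>2 \<le> 0" using coeff_2p_le k by (simp add: power2_eq_square algebra_simps)
  hence s: "max_weight = \<alpha> / 2" by simp
  have "k (2 * p) = max_weight * (\<alpha> - max_weight)" unfolding k(1) s by (simp add: power2_eq_square)
  thus ?thesis
    by (rule not_irreducible) (use pos k s \<beta> c in \<open>auto simp: case3_def\<close>)
qed

end

lemma gap_matrixI:
  assumes p: "p \<ge> 3" and A: "A \<in> carrier_mat (2 * p + 1) (2 * p + 1)" "nonneg_mat A" "char_poly A = gap_poly p k"
  obtains a where "gap_matrix p a k" "A = mat (2 * p + 1) (2 * p + 1) (\<lambda>(i, j). a i j)"
proof -
  define a where "a i j = (if i < 2 * p + 1 \<and> j < 2 * p + 1 then A $$ (i, j) else 0)" for i j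
  have eq: "A = mat (2 * p + 1) (2 * p + 1) (\<lambda>(i, j). a i j)"
    using A(1) by (intro eq_matI) (auto simp: a_def)
  moreover have "gap_matrix p a k"
  proof
    show "0 \<le> a i j" for i j using A(1,2) by (auto simp: a_def nonneg_mat_def)
    show "char_poly (mat (2 * p + 1) (2 * p + 1) (\<lambda>(i, j). a i j)) = gap_poly p k"
      unfolding eq[symmetric] by (rule A(3))
  qed (rule p)
  ultimately show ?thesis using that by blast
qed

theorem theorem28:
  fixes p :: nat and k :: "nat \<Rightarrow> real" and P :: "real poly"
  assumes "p \<ge> 3"
    and "P = monom 1 (2 * p + 1) + (\<Sum>j = p..2 * p + 1. monom (k j) (2 * p + 1 - j))"
    and "P \<noteq> monom 1 (2 * p + 1)"
  shows "(\<not> (case1 p k \<or> case2 p k \<or> case3 p k) \<longrightarrow>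
            (realizable P \<longleftrightarrow> irreducibly_realizable P)) \<and>
         (case1 p k \<or> case2 p k \<or> case3 p k \<longrightarrow> \<not> irreducibly_realizable P)"
proof -
  have P: "P = gap_poly p k" using assms(2) by (simp only: gap_poly_def)
  have deg: "degree P = 2 * p + 1" using assms(1) P by (simp add: degree_gap_poly)
  have nz: "\<exists>j\<in>{p..2 * p + 1}. k j \<noteq> 0"
  proof (rule ccontr)
    assume "\<not> ?thesis"
    hence "(\<Sum>j = p..2 * p + 1. monom (k j) (2 * p + 1 - j)) = 0" by (intro sum.neutral) auto
    thus False using assms(2,3) by simp
  qed
  \<comment> \<open>The given matrix only supplies inequalities between the coefficients; an
    irreducible one is then built afresh from these.\<close>
  have "irreducibly_realizable P" if nc: "\<not> (case1 p k \<or> case2 p k \<or> case3 p k)" and "realizable P"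
  proof -
    obtain A where "A \<in> carrier_mat (2 * p + 1) (2 * p + 1)" "nonneg_mat A" "char_poly A = gap_poly p k"
      using \<open>realizable P\<close> unfolding realizable_def deg P[symmetric] by blast
    then obtain a where "gap_matrix p a k" by (rule gap_matrixI[OF assms(1)])
    then interpret gap_matrix p a k .
    show ?thesis unfolding P
      by (rule irreducibly_realizable_gap_poly[OF assms(1) coeff_nonpos coeff_2p_le_square coeff_2p1_le_extremal nc nz])
  qed
  moreover have "realizable P" if "irreducibly_realizable P"
    using that unfolding realizable_def irreducibly_realizable_def by blast
  moreover have "\<not> irreducibly_realizable P" if c: "case1 p k \<or> case2 p k \<or> case3 p k"
  proof
    assume "irreducibly_realizable P"
    then obtain A where A: "A \<in> carrier_mat (2 * p + 1) (2 * p + 1)" "nonneg_mat A" "char_poly A = gap_poly p k"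
      and irr: "irreducible_mat A"
      unfolding irreducibly_realizable_def deg P[symmetric] by blast
    obtain a where "gap_matrix p a k" and eq: "A = mat (2 * p + 1) (2 * p + 1) (\<lambda>(i, j). a i j)"
      by (rule gap_matrixI[OF assms(1) A])
    then interpret gap_matrix p a k by simp
    show False using not_irreducible_in_cases[OF c] irr eq by simp
  qed
  ultimately show ?thesis by blast
qed

end
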